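(* For $0\le r_1,r_2,r_3\le n$ and $0\le s\le\min(r_1,n-r_1,r_2,n-r_2,r_3,n-r_3)$, $$\Lambda_s^{r_2,r_3}\circ\Lambda_s^{r_1,r_2}=\frac{\binom{n}{r_2}}{\binom{n}{s}-\binom{n}{s-1}}\,\Lambda_s^{r_1,r_3}.$$
   Context: Let $\Omega$ be a finite set with $|\Omega|=n\ge1$, $G=S(\Omega)$, $X=\mathcal P(\Omega)$, $X_r=\{x\in X:|x|=r\}$, $G$ acting on $L^2(X)$ (complex functions on $X$; $L^2(X_r)$ = functions supported on $X_r$) by $(\rho(g)\psi)(x)=\psi(g^{-1}x)$. For $0\le s\le\min(r,n-r)$, $L^2(X_r)_s$ is the unique irreducible $G$-subspace of $L^2(X_r)$ isomorphic to the irreducible representation associated with the partition $(n-s,s)$. For $0\le s\le\min(r_1,n-r_1,r_2,n-r_2)$, $\Lambda_s^{r_1,r_2}$ is a $G$-equivariant map $L^2(X)\to L^2(X)$ sending $L^2(X_{r_1})_s$ into $L^2(X_{r_2})_s$ and vanishing on its orthogonal complement, with kernel $\lambda$ defined on integers $\max(0,r_2-r_1)\le k\le\min(n-r_1,r_2)$ by $(\Lambda_s^{r_1,r_2}\psi)(x_2)=\sum_{x_1\in X_{r_1}}\lambda(|x_2\setminus x_1|)\psi(x_1)$. The kernel agrees on its domain with a unique polynomial of degree $s$ which is nonzero at $0$; $\Lambda_s^{r_1,r_2}$ is normalized so that this polynomial takes the value $1$ at $t=0$. Convention $\binom{n}{-1}=0$. *)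

theory Defs
  imports Main "HOL-Combinatorics.Permutations" "HOL-Computational_Algebra.Polynomial"
begin

text \<open>Functions on X = P(Omega) are modelled as complex functions on 'a set;
 L^2(X) consists of those vanishing outside Pow Omega.\<close>

definition L2X :: "'a set \<Rightarrow> ('a set \<Rightarrow> complex) set" where
  "L2X \<Omega> = {\<psi>. \<forall>x. \<not> x \<subseteq> \<Omega> \<longrightarrow> \<psi> x = 0}"

definition Xr :: "'a set \<Rightarrow> nat \<Rightarrow> 'a set set" where
  "Xr \<Omega> r = {x. x \<subseteq> \<Omega> \<and> card x = r}"

definition L2Xr :: "'a set \<Rightarrow> nat \<Rightarrow> ('a set \<Rightarrow> complex) set" where
  "L2Xr \<Omega> r = {\<psi>. \<forall>x. x \<notin> Xr \<Omega> r \<longrightarrow> \<psi> x = 0}"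

definition act :: "('a \<Rightarrow> 'a) \<Rightarrow> ('a set \<Rightarrow> complex) \<Rightarrow> ('a set \<Rightarrow> complex)" where
  "act g \<psi> = (\<lambda>x. \<psi> (inv g ` x))"

definition csubspace :: "('a set \<Rightarrow> complex) set \<Rightarrow> bool" where
  "csubspace V \<longleftrightarrow> (\<lambda>_. 0) \<in> V \<and> (\<forall>f\<in>V. \<forall>g\<in>V. (\<lambda>x. f x + g x) \<in> V)
     \<and> (\<forall>c. \<forall>f\<in>V. (\<lambda>x. c * f x) \<in> V)"

definition cspan :: "('a set \<Rightarrow> complex) set \<Rightarrow> ('a set \<Rightarrow> complex) set" where
  "cspan S = {f. \<exists>F c. finite F \<and> F \<subseteq> S \<and> f = (\<lambda>x. \<Sum>g\<in>F. c g * g x)}"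

definition G_invariant :: "'a set \<Rightarrow> ('a set \<Rightarrow> complex) set \<Rightarrow> bool" where
  "G_invariant \<Omega> V \<longleftrightarrow> (\<forall>g. g permutes \<Omega> \<longrightarrow> (\<forall>\<psi>\<in>V. act g \<psi> \<in> V))"

definition G_subspace :: "'a set \<Rightarrow> ('a set \<Rightarrow> complex) set \<Rightarrow> bool" where
  "G_subspace \<Omega> V \<longleftrightarrow> csubspace V \<and> G_invariant \<Omega> V"

definition G_irreducible :: "'a set \<Rightarrow> ('a set \<Rightarrow> complex) set \<Rightarrow> bool" where
  "G_irreducible \<Omega> V \<longleftrightarrow> G_subspace \<Omega> V \<and> V \<noteq> {\<lambda>_. 0} \<and>
     (\<forall>W. G_subspace \<Omega> W \<and> W \<subseteq> V \<longrightarrow> W = {\<lambda>_. 0} \<or> W = V)"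

definition G_isomorphic :: "'a set \<Rightarrow> ('a set \<Rightarrow> complex) set \<Rightarrow> ('a set \<Rightarrow> complex) set \<Rightarrow> bool" where
  "G_isomorphic \<Omega> V W \<longleftrightarrow> (\<exists>T. bij_betw T V W
      \<and> (\<forall>f\<in>V. \<forall>g\<in>V. T (\<lambda>x. f x + g x) = (\<lambda>x. T f x + T g x))
      \<and> (\<forall>c. \<forall>f\<in>V. T (\<lambda>x. c * f x) = (\<lambda>x. c * T f x))
      \<and> (\<forall>g. g permutes \<Omega> \<longrightarrow> (\<forall>f\<in>V. T (act g f) = act g (T f))))"

text \<open>Polytabloid of shape (n-s,s) with columns {a i, b i}, i < s, realised in the
 permutation module L^2(X_s): e(x) = prod_i ([a i in x] - [b i in x]) on X_s.\<close>
definition polytabloid :: "'a set \<Rightarrow> nat \<Rightarrow> (nat \<Rightarrow> 'a) \<Rightarrow> (nat \<Rightarrow> 'a) \<Rightarrow> ('a set \<Rightarrow> complex)" where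
  "polytabloid \<Omega> s a b = (\<lambda>x. if x \<in> Xr \<Omega> s then
      (\<Prod>i<s. (if a i \<in> x then 1 else 0) - (if b i \<in> x then 1 else 0)) else 0)"

definition specht :: "'a set \<Rightarrow> nat \<Rightarrow> ('a set \<Rightarrow> complex) set" where
  "specht \<Omega> s = cspan {polytabloid \<Omega> s a b | a b.
      (\<forall>i<s. a i \<in> \<Omega> \<and> b i \<in> \<Omega>) \<and> inj_on (\<lambda>j. if j < s then a j else b (j - s)) {..<2*s}}"

definition L2Xrs :: "'a set \<Rightarrow> nat \<Rightarrow> nat \<Rightarrow> ('a set \<Rightarrow> complex) set" where
  "L2Xrs \<Omega> r s = (THE V. V \<subseteq> L2Xr \<Omega> r \<and> G_irreducible \<Omega> V \<and> G_isomorphic \<Omega> V (specht \<Omega> s))"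

definition orth_compl :: "'a set \<Rightarrow> ('a set \<Rightarrow> complex) set \<Rightarrow> ('a set \<Rightarrow> complex) set" where
  "orth_compl \<Omega> V = {\<phi> \<in> L2X \<Omega>. \<forall>\<psi>\<in>V. (\<Sum>x\<in>Pow \<Omega>. \<phi> x * cnj (\<psi> x)) = 0}"

definition kernel_op :: "'a set \<Rightarrow> nat \<Rightarrow> nat \<Rightarrow> complex poly \<Rightarrow> ('a set \<Rightarrow> complex) \<Rightarrow> ('a set \<Rightarrow> complex)" where
  "kernel_op \<Omega> r1 r2 p \<psi> = (\<lambda>x2. if x2 \<in> Xr \<Omega> r2 then
      (\<Sum>x1\<in>Xr \<Omega> r1. poly p (of_nat (card (x2 - x1))) * \<psi> x1) else 0)"

definition is_Lambda :: "'a set \<Rightarrow> nat \<Rightarrow> nat \<Rightarrow> nat \<Rightarrow> (('a set \<Rightarrow> complex) \<Rightarrow> ('a set \<Rightarrow> complex)) \<Rightarrow> bool" where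
  "is_Lambda \<Omega> s r1 r2 L \<longleftrightarrow>
     (\<exists>p. degree p = s \<and> poly p 0 = 1 \<and> L = kernel_op \<Omega> r1 r2 p)
     \<and> (\<forall>g. g permutes \<Omega> \<longrightarrow> (\<forall>\<psi>\<in>L2X \<Omega>. L (act g \<psi>) = act g (L \<psi>)))
     \<and> (\<forall>\<psi>\<in>L2Xrs \<Omega> r1 s. L \<psi> \<in> L2Xrs \<Omega> r2 s)
     \<and> (\<forall>\<psi>\<in>orth_compl \<Omega> (L2Xrs \<Omega> r1 s). L \<psi> = (\<lambda>_. 0))"

definition Lambda :: "'a set \<Rightarrow> nat \<Rightarrow> nat \<Rightarrow> nat \<Rightarrow> ('a set \<Rightarrow> complex) \<Rightarrow> ('a set \<Rightarrow> complex)" where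
  "Lambda \<Omega> s r1 r2 = (THE L. is_Lambda \<Omega> s r1 r2 L)"

definition ichoose :: "nat \<Rightarrow> int \<Rightarrow> int" where
  "ichoose n k = (if k < 0 then 0 else int (n choose nat k))"

end

theory Submission
  imports Defs "HOL-Library.FuncSet"
begin

text \<open>
  For disjoint \<open>s\<close>-tuples \<open>a, b\<close> of distinct points put
  \<open>e\<^sub>a\<^sub>b x = (\<Prod>i<s. [a i \<in> x] - [b i \<in> x])\<close>; restricted to \<open>r\<close>-subsets these functions span the
  constituent \<open>L2Xrs \<Omega> r s\<close>.  Indeed a function on \<open>r\<close>-subsets that changes sign under each
  transposition \<open>(a i, b i)\<close> and is fixed by the permutations of the remaining points is a multiple of
  \<open>e\<^sub>a\<^sub>b\<close>, which replaces Schur's lemma throughout.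

  The kernel \<open>K x y = (\<Sum>a b. e\<^sub>a\<^sub>b x * e\<^sub>a\<^sub>b y)\<close> therefore induces all operators \<open>Lambda \<Omega> s r1 r2\<close> up to
  scalars.  Orienting each column so that \<open>a i \<in> y\<close> and \<open>b i \<notin> y\<close> and expanding the product exhibits
  \<open>K x y\<close> as a polynomial of degree \<open>s\<close> in \<open>card (x - y)\<close> whose value at \<open>0\<close> is a product of falling
  factorials; this determines the scalars.  Summing over \<open>s\<close>-subsets contained in, or \<open>r\<close>-subsets
  containing, a given set reduces the eigenvalue of \<open>K\<close> on \<open>e\<^sub>a\<^sub>b\<close> to the case \<open>r = s\<close>, where it is
  evaluated at the single point \<open>a ` {..<s}\<close>.
\<close>

section \<open>Signs of subsets along a family of columns\<close>

text \<open>\<open>L2Xrs\<close> and \<open>Lambda\<close> are definite descriptions, so existence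
  and uniqueness must be settled for both before anything can be computed. For \<open>Lambda\<close>
  this includes the kernel polynomial: the operator fixes it only at the values of
  \<open>card (x - y)\<close> that occur, and the hypotheses provide at least \<open>s + 1\<close>
  of them, enough for degree \<open>s\<close>.

  The bounds \<open>s \<le> r\<close> and \<open>r + s \<le> n\<close> also make
  \<open>(n - 2 * s) choose (r - s)\<close> nonzero. On the span of the polytabloids, summing down
  to \<open>s\<close>-subsets and up again is multiplication by this number, so the levels
  \<open>r\<close> and \<open>s\<close> carry the same information.

  Level \<open>s\<close> is the easy one: a set with nonzero sign is there a transversal of the
  columns and nothing else, so only \<open>2 ^ s\<close> sets contribute to the eigenvalue.

  The factor in the theorem is the scalar by which \<open>Lambda \<Omega> s r2 r2\<close> acts on
  its constituent. A trace explains it: the diagonal entries of that operator on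
  \<open>Xr \<Omega> r2\<close> are 1, and the constituent has dimension
  \<open>ichoose n s - ichoose n (s - 1)\<close>. The proof reaches the same quotient from the
  explicit eigenvalue.\<close>

definition columns :: "'a set \<Rightarrow> nat \<Rightarrow> (nat \<Rightarrow> 'a) \<Rightarrow> (nat \<Rightarrow> 'a) \<Rightarrow> bool" where
  "columns \<Omega> s a b \<longleftrightarrow> a ` {..<s} \<subseteq> \<Omega> \<and> b ` {..<s} \<subseteq> \<Omega> \<and> inj_on a {..<s} \<and> inj_on b {..<s}
     \<and> a ` {..<s} \<inter> b ` {..<s} = {}"

definition column_sign :: "nat \<Rightarrow> (nat \<Rightarrow> 'a) \<Rightarrow> (nat \<Rightarrow> 'a) \<Rightarrow> 'a set \<Rightarrow> complex" where
  "column_sign s a b x = (\<Prod>i<s. (if a i \<in> x then 1 else 0) - (if b i \<in> x then 1 else 0))"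

text \<open>Translates the single injectivity condition on \<open>2 * s\<close> indices in
  \<open>specht\<close>, so that \<open>specht\<close> can be recognised as a
  \<open>polytab_space\<close>.\<close>

lemma columns_iff:
  "columns \<Omega> s a b \<longleftrightarrow> (\<forall>i<s. a i \<in> \<Omega> \<and> b i \<in> \<Omega>)
     \<and> inj_on (\<lambda>j. if j < s then a j else b (j - s)) {..<2 * s}"
proof -
  have split: "{..<2 * s} = {..<s} \<union> (\<lambda>i. i + s) ` {..<s}"
    by (auto simp: image_iff) (metis add.commute le_Suc_ex lessThan_iff linorder_not_less mult_2 nat_add_left_cancel_less)
  define c where "c = (\<lambda>j. if j < s then a j else b (j - s))"
  have 1: "inj_on c {..<s} \<longleftrightarrow> inj_on a {..<s}" "c ` {..<s} = a ` {..<s}"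
    by (auto simp: c_def inj_on_def)
  have 2: "inj_on c ((\<lambda>i. i + s) ` {..<s}) \<longleftrightarrow> inj_on b {..<s}"
    "c ` (\<lambda>i. i + s) ` {..<s} = b ` {..<s}"
    unfolding image_image by (simp_all add: c_def inj_on_def)
  have 3: "{..<s} - (\<lambda>i. i + s) ` {..<s} = {..<s}" "(\<lambda>i. i + s) ` {..<s} - {..<s} = (\<lambda>i. i + s) ` {..<s}"
    by auto
  show ?thesis
    unfolding columns_def split c_def[symmetric] inj_on_Un 3 1 2 by blast
qed

lemma columnsD:
  assumes "columns \<Omega> s a b"
  shows "i < s \<Longrightarrow> a i \<in> \<Omega>" "i < s \<Longrightarrow> b i \<in> \<Omega>"
    "i < s \<Longrightarrow> j < s \<Longrightarrow> a i = a j \<longleftrightarrow> i = j" "i < s \<Longrightarrow> j < s \<Longrightarrow> b i = b j \<longleftrightarrow> i = j"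
    "i < s \<Longrightarrow> j < s \<Longrightarrow> a i \<noteq> b j" "i < s \<Longrightarrow> j < s \<Longrightarrow> b i \<noteq> a j"
  using assms unfolding columns_def inj_on_def by blast+

lemma column_sign_eq_0_iff: "column_sign s a b x = 0 \<longleftrightarrow> (\<exists>i<s. a i \<in> x \<longleftrightarrow> b i \<in> x)"
  by (auto simp: column_sign_def)

lemma cnj_column_sign: "cnj (column_sign s a b x) = column_sign s a b x"
  by (auto simp: column_sign_def intro!: prod.cong)

lemma column_sign_cong:
  assumes "\<And>i. i < s \<Longrightarrow> a i \<in> x \<longleftrightarrow> a' i \<in> x'" "\<And>i. i < s \<Longrightarrow> b i \<in> x \<longleftrightarrow> b' i \<in> x'"
  shows "column_sign s a b x = column_sign s a' b' x'"
  unfolding column_sign_def using assms by (intro prod.cong) auto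

lemma column_sign_inv_image:
  assumes "bij g"
  shows "column_sign s a b (inv g ` x) = column_sign s (g \<circ> a) (g \<circ> b) x"
proof -
  have "y \<in> inv g ` x \<longleftrightarrow> g y \<in> x" for y
    using bij_vimage_eq_inv_image[OF assms, of x] by auto
  then show ?thesis by (intro column_sign_cong) auto
qed

lemma column_sign_transpose:
  assumes "columns \<Omega> s a b" "i < s"
  shows "column_sign s a b (transpose (a i) (b i) ` x) = - column_sign s a b x"
proof -
  let ?f = "\<lambda>x j. (if a j \<in> x then 1 else 0 :: complex) - (if b j \<in> x then 1 else 0)"
  let ?y = "transpose (a i) (b i) ` x"
  have "column_sign s a b ?y = ?f ?y i * (\<Prod>j\<in>{..<s} - {i}. ?f ?y j)"
    unfolding column_sign_def using assms by (subst prod.remove[of _ i]) auto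
  also have "?f ?y i = - ?f x i"
    by (auto simp: in_transpose_image_iff)
  also have "(\<Prod>j\<in>{..<s} - {i}. ?f ?y j) = (\<Prod>j\<in>{..<s} - {i}. ?f x j)"
    using columnsD[OF assms(1)] assms(2)
    by (intro prod.cong refl) (simp add: in_transpose_image_iff)
  also have "- ?f x i * \<dots> = - column_sign s a b x"
    unfolding column_sign_def using assms by (subst (2) prod.remove[of _ i]) auto
  finally show ?thesis .
qed

lemma transpose_mem_Xr:
  assumes "columns \<Omega> s a b" "i < s"
  shows "transpose (a i) (b i) ` x \<in> Xr \<Omega> r \<longleftrightarrow> x \<in> Xr \<Omega> r"
proof -
  have "transpose (a i) (b i) ` \<Omega> = \<Omega>"
    using columnsD[OF assms(1)] assms(2) by simp
  then have "transpose (a i) (b i) ` x \<subseteq> \<Omega> \<longleftrightarrow> x \<subseteq> \<Omega>"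
    by (metis inj_image_subset_iff inj_transpose)
  then show ?thesis by (simp add: Xr_def card_image)
qed

text \<open>A sign-reversing involution: the transposition permutes \<open>S\<close>, preserves the
  weight and negates the sign.\<close>

lemma sum_column_sign_cancel:
  assumes "columns \<Omega> s a b" "i < s"
    and S: "\<And>x. x \<in> S \<Longrightarrow> transpose (a i) (b i) ` x \<in> S"
    and w: "\<And>x. x \<in> S \<Longrightarrow> w (transpose (a i) (b i) ` x) = w x"
  shows "(\<Sum>x\<in>S. w x * column_sign s a b x) = 0"
proof -
  let ?t = "transpose (a i) (b i)"
  have tt: "?t ` ?t ` x = x" for x by (simp add: image_image)
  have "(\<Sum>x\<in>S. w x * column_sign s a b x) = (\<Sum>x\<in>S. w (?t ` x) * column_sign s a b (?t ` x))"
    by (rule sum.reindex_bij_witness[of _ "image ?t" "image ?t"]) (auto simp: S tt)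
  also have "\<dots> = - (\<Sum>x\<in>S. w x * column_sign s a b x)"
    by (simp add: w column_sign_transpose[OF assms(1,2)] sum_negf[symmetric])
  finally show ?thesis by simp
qed

lemma finite_Xr: "finite \<Omega> \<Longrightarrow> finite (Xr \<Omega> r)"
  by (simp add: Xr_def)

lemma card_transversal:
  assumes "columns \<Omega> s a b" "\<And>i. i < s \<Longrightarrow> (a i \<in> x) \<noteq> (b i \<in> x)"
  shows "card (x \<inter> (a ` {..<s} \<union> b ` {..<s})) = s"
proof -
  let ?c = "\<lambda>i. if a i \<in> x then a i else b i"
  have eq: "x \<inter> (a ` {..<s} \<union> b ` {..<s}) = ?c ` {..<s}"
    using assms(2) by auto
  have inj: "inj_on ?c {..<s}"
    using columnsD[OF assms(1)] by (auto simp: inj_on_def split: if_splits)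
  show ?thesis unfolding eq card_image[OF inj] by simp
qed

text \<open>If \<open>x\<close> contains none or both entries of some column, swapping that column
  permutes the subsets of \<open>x\<close> and the sum cancels. Otherwise the transversal that
  \<open>x\<close> cuts out of the columns is its only \<open>s\<close>-subset with nonzero
  sign.\<close>

lemma column_sign_eq_sum_subsets:
  assumes "finite \<Omega>" "columns \<Omega> s a b" "x \<subseteq> \<Omega>"
  shows "column_sign s a b x = (\<Sum>y | y \<in> Xr \<Omega> s \<and> y \<subseteq> x. column_sign s a b y)"
proof (cases "column_sign s a b x = 0")
  case True
  then obtain i where i: "i < s" "a i \<in> x \<longleftrightarrow> b i \<in> x"
    by (auto simp: column_sign_eq_0_iff)
  have "transpose (a i) (b i) ` y \<subseteq> x" if "y \<subseteq> x" for y
    using that i(2) transpose_image_eq[OF i(2)] by blast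
  then have "(\<Sum>y | y \<in> Xr \<Omega> s \<and> y \<subseteq> x. 1 * column_sign s a b y) = 0"
    using i by (intro sum_column_sign_cancel[OF assms(2) i(1)]) (auto simp: transpose_mem_Xr[OF assms(2) i(1)])
  with True show ?thesis by simp
next
  case False
  define C where "C = a ` {..<s} \<union> b ` {..<s}"
  have x: "\<And>i. i < s \<Longrightarrow> (a i \<in> x) \<noteq> (b i \<in> x)" using False by (auto simp: column_sign_eq_0_iff)
  have z: "x \<inter> C \<in> {y. y \<in> Xr \<Omega> s \<and> y \<subseteq> x}"
    using card_transversal[OF assms(2) x] assms(3) by (auto simp: Xr_def C_def)
  have "column_sign s a b y = 0" if y: "y \<in> Xr \<Omega> s" "y \<subseteq> x" "y \<noteq> x \<inter> C" for y
  proof (rule ccontr)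
    assume "column_sign s a b y \<noteq> 0"
    then have "card (y \<inter> C) = s"
      unfolding C_def by (intro card_transversal[OF assms(2)]) (auto simp: column_sign_eq_0_iff)
    moreover have "finite y" "card y = s" using y(1) assms(1) by (auto simp: Xr_def intro: finite_subset)
    ultimately have "y \<inter> C = y" by (metis card_subset_eq inf_le1)
    then have "y \<subseteq> x \<inter> C" using y by auto
    moreover have "card (x \<inter> C) = card y" using z y by (auto simp: Xr_def)
    moreover have "finite (x \<inter> C)" by (simp add: C_def)
    ultimately show False using y(3) by (metis card_subset_eq)
  qed
  then have "(\<Sum>y | y \<in> Xr \<Omega> s \<and> y \<subseteq> x. column_sign s a b y) = (\<Sum>y\<in>{x \<inter> C}. column_sign s a b y)"
    using z finite_Xr[OF assms(1)] by (intro sum.mono_neutral_right) (auto intro: finite_subset)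
  also have "\<dots> = column_sign s a b x"
    by (simp, rule column_sign_cong) (auto simp: C_def)
  finally show ?thesis by simp
qed

lemma card_columns:
  assumes "columns \<Omega> s a b"
  shows "card (a ` {..<s} \<union> b ` {..<s}) = 2 * s"
  using assms by (subst card_Un_disjoint) (auto simp: columns_def card_image)

text \<open>If \<open>y\<close> misses a column, swapping that column permutes the supersets of
  \<open>y\<close> and the sum cancels. Otherwise \<open>y\<close> is a transversal, and a superset
  with nonzero sign can only add \<open>r - s\<close> points outside all columns.\<close>

lemma sum_column_sign_supersets:
  assumes fin: "finite \<Omega>" and col: "columns \<Omega> s a b" and y: "y \<in> Xr \<Omega> s" and r: "s \<le> r"
  shows "(\<Sum>x | x \<in> Xr \<Omega> r \<and> y \<subseteq> x. column_sign s a b x)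
    = of_nat ((card \<Omega> - 2 * s) choose (r - s)) * column_sign s a b y"
proof (cases "\<exists>i<s. a i \<notin> y \<and> b i \<notin> y")
  case True
  then obtain i where i: "i < s" "a i \<notin> y" "b i \<notin> y" by blast
  have "y \<subseteq> transpose (a i) (b i) ` x" if "y \<subseteq> x" for x
    using that i transpose_image_eq[of "a i" y "b i"] by (metis image_mono)
  then have "(\<Sum>x | x \<in> Xr \<Omega> r \<and> y \<subseteq> x. 1 * column_sign s a b x) = 0"
    using i by (intro sum_column_sign_cancel[OF col i(1)]) (auto simp: transpose_mem_Xr[OF col i(1)])
  moreover have "column_sign s a b y = 0" using i by (auto simp: column_sign_eq_0_iff)
  ultimately show ?thesis by simp
next
  case False
  define C where "C = a ` {..<s} \<union> b ` {..<s}"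
  \<comment> \<open>\<open>c\<close> picks an entry of \<open>y\<close> from each column. As
    \<open>y\<close> has only \<open>s\<close> elements, these exhaust it, so no column lies
    entirely in \<open>y\<close>.\<close>
  define c where "c = (\<lambda>i. if a i \<in> y then a i else b i)"
  have c: "c ` {..<s} \<subseteq> y" using False by (auto simp: c_def)
  have "inj_on c {..<s}"
    using columnsD[OF col] by (auto simp: inj_on_def c_def split: if_splits)
  moreover have fy: "finite y" "card y = s" "y \<subseteq> \<Omega>" using y fin by (auto simp: Xr_def intro: finite_subset)
  ultimately have cy: "c ` {..<s} = y" using c by (metis card_image card_lessThan card_subset_eq)
  have yC: "y \<subseteq> C" unfolding cy[symmetric] by (auto simp: c_def C_def)
  have one: "(a i \<in> y) \<noteq> (b i \<in> y)" if "i < s" for i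
  proof -
    have "b i \<notin> y" if "a i \<in> y"
    proof
      assume "b i \<in> y"
      then obtain j where "j < s" "b i = c j" using cy by blast
      then show False using columnsD[OF col] \<open>i < s\<close> that by (auto simp: c_def split: if_splits)
    qed
    then show ?thesis using False that by blast
  qed
  have C\<Omega>: "C \<subseteq> \<Omega>" using col by (auto simp: columns_def C_def)
  let ?T = "{R. R \<subseteq> \<Omega> - C \<and> card R = r - s}"
  let ?S = "{x. x \<in> Xr \<Omega> r \<and> y \<subseteq> x}"
  have "(\<Sum>x\<in>?S. column_sign s a b x) = (\<Sum>x\<in>(\<lambda>R. y \<union> R) ` ?T. column_sign s a b x)"
  proof (rule sum.mono_neutral_right)
    show "finite ?S" using fin by (simp add: finite_Xr)
    show "(\<lambda>R. y \<union> R) ` ?T \<subseteq> ?S"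
    proof clarify
      fix R assume R: "R \<subseteq> \<Omega> - C" "card R = r - s"
      have "card (y \<union> R) = card y + card R"
        using R yC fy fin by (intro card_Un_disjoint) (auto intro: finite_subset)
      then show "y \<union> R \<in> Xr \<Omega> r \<and> y \<subseteq> y \<union> R"
        using R fy r by (auto simp: Xr_def)
    qed
    show "\<forall>x\<in>?S - (\<lambda>R. y \<union> R) ` ?T. column_sign s a b x = 0"
    proof (rule ballI, rule ccontr)
      fix x assume x: "x \<in> ?S - (\<lambda>R. y \<union> R) ` ?T" and "column_sign s a b x \<noteq> 0"
      then have "card (x \<inter> C) = s"
        unfolding C_def by (intro card_transversal[OF col]) (auto simp: column_sign_eq_0_iff)
      moreover have fx: "finite x" using x fin by (auto simp: Xr_def intro: finite_subset)
      moreover have "y \<subseteq> x \<inter> C" using x yC by auto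
      ultimately have xy: "y = x \<inter> C" using fy by (metis card_subset_eq finite_Int)
      have "card (x - y) = r - s" using fx x fy by (subst card_Diff_subset) (auto simp: Xr_def)
      moreover have "x - y \<subseteq> \<Omega> - C" using x xy by (auto simp: Xr_def)
      ultimately have "y \<union> (x - y) \<in> (\<lambda>R. y \<union> R) ` ?T" by blast
      moreover have "y \<union> (x - y) = x" using x by auto
      ultimately show False using x by simp
    qed
  qed
  also have "\<dots> = (\<Sum>R\<in>?T. column_sign s a b (y \<union> R))"
    using yC by (subst sum.reindex) (auto simp: inj_on_def o_def)
  also have "\<dots> = (\<Sum>R\<in>?T. column_sign s a b y)"
    by (intro sum.cong refl column_sign_cong) (auto simp: C_def)
  also have "\<dots> = of_nat (card ?T) * column_sign s a b y" by simp
  also have "card ?T = (card \<Omega> - 2 * s) choose (r - s)"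
    using fin C\<Omega> card_columns[OF col] by (subst n_subsets) (auto simp: C_def card_Diff_subset)
  finally show ?thesis .
qed

text \<open>Expanding one sign over \<open>s\<close>-subsets and exchanging the sums turns the other
  into a sum over supersets. The factor does not depend on the columns, which is what later moves
  eigenvalues from level \<open>r\<close> to level \<open>s\<close>.\<close>

lemma sum_column_sign_mult:
  assumes fin: "finite \<Omega>" and col: "columns \<Omega> s a b" "columns \<Omega> s a' b'" and r: "s \<le> r"
  shows "(\<Sum>x\<in>Xr \<Omega> r. column_sign s a b x * column_sign s a' b' x)
    = of_nat ((card \<Omega> - 2 * s) choose (r - s)) * (\<Sum>x\<in>Xr \<Omega> s. column_sign s a b x * column_sign s a' b' x)"
proof -
  have "(\<Sum>x\<in>Xr \<Omega> r. column_sign s a b x * column_sign s a' b' x)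
      = (\<Sum>x\<in>Xr \<Omega> r. \<Sum>y | y \<in> Xr \<Omega> s \<and> y \<subseteq> x. column_sign s a b y * column_sign s a' b' x)"
    by (intro sum.cong refl, subst column_sign_eq_sum_subsets[OF fin col(1)])
       (auto simp: sum_distrib_right Xr_def)
  also have "\<dots> = (\<Sum>y\<in>Xr \<Omega> s. \<Sum>x | x \<in> Xr \<Omega> r \<and> y \<subseteq> x. column_sign s a b y * column_sign s a' b' x)"
    by (rule sum.swap_restrict) (simp_all add: fin finite_Xr)
  also have "\<dots> = (\<Sum>y\<in>Xr \<Omega> s. column_sign s a b y * (of_nat ((card \<Omega> - 2 * s) choose (r - s)) * column_sign s a' b' y))"
    by (intro sum.cong refl) (simp add: sum_distrib_left[symmetric] sum_column_sign_supersets[OF fin col(2) _ r])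
  finally show ?thesis by (simp add: sum_distrib_left mult_ac)
qed

section \<open>The column kernel as a polynomial in the size of the difference\<close>

lemma columnsI:
  assumes "\<And>i. i < s \<Longrightarrow> a i \<in> \<Omega>" "\<And>i. i < s \<Longrightarrow> b i \<in> \<Omega>"
    "\<And>i j. i < s \<Longrightarrow> j < s \<Longrightarrow> a i = a j \<Longrightarrow> i = j" "\<And>i j. i < s \<Longrightarrow> j < s \<Longrightarrow> b i = b j \<Longrightarrow> i = j"
    "\<And>i j. i < s \<Longrightarrow> j < s \<Longrightarrow> a i \<noteq> b j"
  shows "columns \<Omega> s a b"
  unfolding columns_def inj_on_def using assms by fastforce

text \<open>Extensionality makes this a finite set in which each pair of tuples occurs once;
  \<open>columns\<close> alone leaves the values beyond \<open>s\<close> free.\<close>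

definition column_pairs :: "'a set \<Rightarrow> nat \<Rightarrow> ((nat \<Rightarrow> 'a) \<times> (nat \<Rightarrow> 'a)) set" where
  "column_pairs \<Omega> s = {(a, b). a \<in> {..<s} \<rightarrow>\<^sub>E \<Omega> \<and> b \<in> {..<s} \<rightarrow>\<^sub>E \<Omega> \<and> columns \<Omega> s a b}"

definition column_kernel :: "'a set \<Rightarrow> nat \<Rightarrow> 'a set \<Rightarrow> 'a set \<Rightarrow> complex" where
  "column_kernel \<Omega> s x y = (\<Sum>(a, b)\<in>column_pairs \<Omega> s. column_sign s a b x * column_sign s a b y)"

section \<open>Falling factorials and counting of injections\<close>

definition ffact :: "nat \<Rightarrow> nat \<Rightarrow> nat" where
  "ffact n k = (\<Prod>i<k. n - i)"

lemma finite_column_pairs: "finite \<Omega> \<Longrightarrow> finite (column_pairs \<Omega> s)"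
  by (rule finite_subset[of _ "({..<s} \<rightarrow>\<^sub>E \<Omega>) \<times> ({..<s} \<rightarrow>\<^sub>E \<Omega>)"])
     (auto simp: column_pairs_def intro!: finite_PiE)

text \<open>No side condition is required: for \<open>k > n\<close> both the truncated and the ring
  subtraction give a zero factor at \<open>i = n\<close>.\<close>

lemma of_nat_ffact: "(of_nat (ffact n k) :: 'b::{comm_ring_1}) = (\<Prod>i<k. of_nat n - of_nat i)"
proof (cases "k \<le> n")
  case True
  then show ?thesis by (simp add: ffact_def of_nat_diff)
next
  case False
  then have "ffact n k = 0" "(\<Prod>i<k. of_nat n - of_nat i :: 'b) = 0"
    by (auto simp: ffact_def not_le intro!: prod_zero bexI[of _ n])
  then show ?thesis by simp
qed

lemma ffact_fact: "k \<le> n \<Longrightarrow> ffact n k * fact (n - k) = fact n"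
proof (induction k)
  case (Suc k)
  have "fact (n - k) = (n - k) * fact (n - Suc k)"
    using Suc.prems by (simp add: fact_reduce)
  then show ?case using Suc by (simp add: ffact_def mult.assoc)
qed (simp add: ffact_def)

lemma ffact_eq_0_iff: "ffact n k = 0 \<longleftrightarrow> n < k"
  by (auto simp: ffact_def)

lemma ffact_self: "ffact n n = fact n"
  using ffact_fact[of n n] by simp

lemma ffact_binomial: "ffact n k = fact k * (n choose k)"
proof (cases "k \<le> n")
  case True
  then have "ffact n k * fact (n - k) = (fact k * (n choose k)) * fact (n - k)"
    by (simp add: ffact_fact binomial_fact_lemma[of k n, symmetric] mult_ac)
  then show ?thesis by simp
next
  case False
  then have "ffact n k = 0" "n choose k = 0" by (auto simp: ffact_eq_0_iff)
  then show ?thesis by simp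
qed

text \<open>The new range contains all the old ones, so the values already used occupy exactly
  \<open>card I\<close> of its points, and the number of choices left does not depend on
  \<open>a\<close>.\<close>

lemma card_inj_PiE_insert:
  assumes fin: "finite I" "finite (Z i)" and i: "i \<notin> I" and sub: "\<And>j. j \<in> I \<Longrightarrow> Z j \<subseteq> Z i"
  shows "card {a \<in> PiE (insert i I) Z. inj_on a (insert i I)}
    = card {a \<in> PiE I Z. inj_on a I} * (card (Z i) - card I)"
proof -
  let ?M = "{a \<in> PiE I Z. inj_on a I}"
  let ?f = "\<lambda>(a, y). a(i := y)"
  have "{a \<in> PiE (insert i I) Z. inj_on a (insert i I)} = ?f ` (SIGMA a:?M. Z i - a ` I)"
  proof (intro set_eqI iffI)
    fix a assume a: "a \<in> {a \<in> PiE (insert i I) Z. inj_on a (insert i I)}"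
    have "a = ?f (restrict a I, a i)"
      using a i by (auto simp: fun_eq_iff restrict_def PiE_def extensional_def)
    moreover have "(restrict a I, a i) \<in> (SIGMA a:?M. Z i - a ` I)"
      using a i by (auto simp: inj_on_def)
    ultimately show "a \<in> ?f ` (SIGMA a:?M. Z i - a ` I)" by blast
  next
    fix c assume "c \<in> ?f ` (SIGMA a:?M. Z i - a ` I)"
    then obtain a z where c: "c = a(i := z)" and a: "a \<in> PiE I Z" "inj_on a I" "z \<in> Z i" "z \<notin> a ` I"
      by auto
    have "c ` I = a ` I" "inj_on c I \<longleftrightarrow> inj_on a I"
      unfolding c using i by (auto intro!: inj_on_cong)
    then show "c \<in> {a \<in> PiE (insert i I) Z. inj_on a (insert i I)}"
      using a i by (auto simp: c intro!: PiE_fun_upd)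
  qed
  moreover have "inj_on ?f (SIGMA a:?M. Z i - a ` I)"
  proof (rule inj_onI, clarify)
    fix a y a' y' assume *: "a \<in> PiE I Z" "a' \<in> PiE I Z" "a(i := y) = a'(i := y')"
    have "a j = a' j" for j
      using fun_cong[OF *(3), of j] *(1,2) i by (cases "j = i") (auto simp: PiE_def extensional_def)
    moreover have "y = y'" using fun_cong[OF *(3), of i] by simp
    ultimately show "a = a' \<and> y = y'" by auto
  qed
  moreover have "finite (PiE I Z)" using fin sub by (auto intro!: finite_PiE intro: finite_subset)
  moreover then have "card (SIGMA a:?M. Z i - a ` I) = (\<Sum>a\<in>?M. card (Z i - a ` I))"
    using fin by (intro card_SigmaI) auto
  moreover have "card (Z i - a ` I) = card (Z i) - card I" if "a \<in> ?M" for a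
    using that sub fin by (subst card_Diff_subset) (auto simp: card_image)
  ultimately show ?thesis by (simp add: card_image)
qed

text \<open>The constrained coordinates \<open>J\<close> are filled first: since
  \<open>Y \<subseteq> X\<close>, this is the order in which every new range contains the earlier
  ones.\<close>

lemma card_inj_PiE:
  assumes fin: "finite I" "finite X" and "Y \<subseteq> X" "J \<subseteq> I"
  shows "card {a \<in> I \<rightarrow>\<^sub>E X. inj_on a I \<and> a ` J \<subseteq> Y}
    = ffact (card Y) (card J) * ffact (card X - card J) (card I - card J)"
proof -
  define Z where "Z = (\<lambda>i. if i \<in> J then Y else X)"
  have fY: "finite Y" "finite J" using assms finite_subset by auto
  have "card {a \<in> PiE (J \<union> K) Z. inj_on a (J \<union> K)} = ffact (card Y) (card J) * ffact (card X - card J) (card K)"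
    if "finite K" "K \<inter> J = {}" for K
    using that
  proof (induction K)
    case empty
    have "PiE J Z = J \<rightarrow>\<^sub>E Y" by (rule PiE_cong) (simp add: Z_def)
    then show ?case using card_inj_on_subset_funcset[OF fY(2,1), of J]
      by (simp add: ffact_def atLeast0LessThan)
  next
    case (insert i K)
    have "card {a \<in> PiE (insert i (J \<union> K)) Z. inj_on a (insert i (J \<union> K))}
      = card {a \<in> PiE (J \<union> K) Z. inj_on a (J \<union> K)} * (card (Z i) - card (J \<union> K))"
      using insert fY assms by (intro card_inj_PiE_insert) (auto simp: Z_def)
    moreover have "card (J \<union> K) = card J + card K"
      using insert fY by (intro card_Un_disjoint) auto
    moreover have "Z i = X" using insert by (auto simp: Z_def)
    ultimately show ?case using insert by (simp add: ffact_def Un_commute)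
  qed
  from this[of "I - J"] have "card {a \<in> PiE I Z. inj_on a I}
      = ffact (card Y) (card J) * ffact (card X - card J) (card (I - J))"
    using assms by (simp add: Un_absorb1 Diff_Int_distrib2)
  moreover have "{a \<in> PiE I Z. inj_on a I} = {a \<in> I \<rightarrow>\<^sub>E X. inj_on a I \<and> a ` J \<subseteq> Y}"
    using assms by (auto simp: Z_def PiE_iff split: if_splits)
  ultimately show ?thesis using assms fY by (simp add: card_Diff_subset)
qed

lemma sum_Pow_card:
  fixes f :: "nat \<Rightarrow> 'b::comm_semiring_1"
  assumes "finite A"
  shows "(\<Sum>J\<in>Pow A. f (card J)) = (\<Sum>j\<le>card A. of_nat (card A choose j) * f j)"
proof -
  have "(\<Sum>J\<in>Pow A. f (card J)) = (\<Sum>j\<le>card A. \<Sum>J | J \<in> Pow A \<and> card J = j. f (card J))"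
    using assms by (intro sum.group[symmetric]) (auto intro: card_mono)
  also have "\<dots> = (\<Sum>j\<le>card A. of_nat (card {J. J \<subseteq> A \<and> card J = j}) * f j)"
    by (intro sum.cong refl) simp
  finally show ?thesis using assms by (simp add: n_subsets)
qed

section \<open>Exchanging the entries of a set of columns\<close>

definition column_swap :: "nat set \<Rightarrow> (nat \<Rightarrow> 'a) \<times> (nat \<Rightarrow> 'a) \<Rightarrow> (nat \<Rightarrow> 'a) \<times> (nat \<Rightarrow> 'a)" where
  "column_swap J = (\<lambda>(a, b). (\<lambda>i. if i \<in> J then b i else a i, \<lambda>i. if i \<in> J then a i else b i))"

lemma column_swap_involution: "column_swap J (column_swap J ab) = ab"
  by (auto simp: column_swap_def split: prod.splits)

lemma column_swap_column_pairs:
  assumes "J \<subseteq> {..<s}" "ab \<in> column_pairs \<Omega> s"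
  shows "column_swap J ab \<in> column_pairs \<Omega> s"
proof -
  obtain a b where ab: "ab = (a, b)" by (cases ab)
  have col: "columns \<Omega> s a b" and e: "a \<in> extensional {..<s}" "b \<in> extensional {..<s}"
    using assms by (simp_all add: ab column_pairs_def PiE_def)
  note D = columnsD[OF col]
  have "columns \<Omega> s (fst (column_swap J ab)) (snd (column_swap J ab))"
    by (rule columnsI) (use D in \<open>auto simp: ab column_swap_def split: if_splits\<close>)
  moreover have "fst (column_swap J ab) \<in> extensional {..<s}" "snd (column_swap J ab) \<in> extensional {..<s}"
    using e assms(1) by (auto simp: ab column_swap_def extensional_def)
  ultimately show ?thesis
    by (auto simp: column_pairs_def PiE_def split: prod.splits dest: columnsD)
qed

lemma column_sign_column_swap:
  assumes "J \<subseteq> {..<s}"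
  shows "column_sign s (fst (column_swap J (a, b))) (snd (column_swap J (a, b))) x
    = (-1) ^ card J * column_sign s a b x"
proof -
  let ?f = "\<lambda>i. (if a i \<in> x then 1 else 0 :: complex) - (if b i \<in> x then 1 else 0)"
  have "column_sign s (fst (column_swap J (a, b))) (snd (column_swap J (a, b))) x
    = (\<Prod>i<s. (if i \<in> J then - 1 else 1) * ?f i)"
    unfolding column_sign_def column_swap_def by (intro prod.cong) auto
  also have "\<dots> = (\<Prod>i<s. if i \<in> J then - 1 else 1) * column_sign s a b x"
    by (simp add: prod.distrib column_sign_def)
  also have "(\<Prod>i<s. if i \<in> J then - 1 else 1 :: complex) = (\<Prod>i\<in>J. - 1)"
    using assms by (simp add: prod.inter_restrict[symmetric] Int_absorb1)
  finally show ?thesis by simp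
qed

text \<open>In each factor the case of both entries in \<open>x\<close> cancels, which leaves a
  difference of two exclusive indicators. In the expanded product, \<open>J\<close> is the set of
  columns contributing the second indicator, and swapping them restores the orientation top in,
  bottom out.\<close>

lemma column_sign_eq_sum_swap:
  "column_sign s a b x = (\<Sum>J\<in>Pow {..<s}. (-1) ^ card J *
     of_bool (\<forall>i<s. fst (column_swap J (a, b)) i \<in> x \<and> snd (column_swap J (a, b)) i \<notin> x))"
proof -
  let ?p = "\<lambda>i. of_bool (a i \<in> x \<and> b i \<notin> x) :: complex" and ?q = "\<lambda>i. of_bool (b i \<in> x \<and> a i \<notin> x) :: complex"
  have "column_sign s a b x = (\<Prod>i<s. ?p i - ?q i)"
    unfolding column_sign_def by (intro prod.cong) auto
  also have "\<dots> = (\<Sum>J\<in>Pow {..<s}. (-1) ^ card J * prod ?q J * prod ?p ({..<s} - J))"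
    by (rule prod_diff_conv_sum) simp
  also have "\<dots> = (\<Sum>J\<in>Pow {..<s}. (-1) ^ card J *
     of_bool (\<forall>i<s. fst (column_swap J (a, b)) i \<in> x \<and> snd (column_swap J (a, b)) i \<notin> x))"
  proof (intro sum.cong refl)
    fix J assume J: "J \<in> Pow {..<s}"
    then have fJ: "finite J" by (auto intro: finite_subset)
    have ind: "(\<Prod>i\<in>A. of_bool (P i) :: complex) = of_bool (\<forall>i\<in>A. P i)" if "finite A" for A and P :: "nat \<Rightarrow> bool"
      using that by (induction A) auto
    have "(\<forall>i\<in>J. b i \<in> x \<and> a i \<notin> x) \<and> (\<forall>i\<in>{..<s} - J. a i \<in> x \<and> b i \<notin> x)
      \<longleftrightarrow> (\<forall>i<s. fst (column_swap J (a, b)) i \<in> x \<and> snd (column_swap J (a, b)) i \<notin> x)"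
      using J by (auto simp: column_swap_def split: if_splits)
    then show "(-1) ^ card J * prod ?q J * prod ?p ({..<s} - J) = (-1) ^ card J *
      of_bool (\<forall>i<s. fst (column_swap J (a, b)) i \<in> x \<and> snd (column_swap J (a, b)) i \<notin> x)"
      using fJ by (simp only: ind finite_Diff finite_lessThan mult.assoc of_bool_conj[symmetric])
  qed
  finally show ?thesis .
qed

text \<open>Reversing the columns in which the entries of \<open>y\<close> are at the bottom makes the dependence
  on \<open>x\<close> polynomial of degree \<open>s\<close> instead of \<open>2 * s\<close>.\<close>

lemma column_kernel_eq_oriented_sum:
  assumes fin: "finite \<Omega>" and y: "y \<subseteq> \<Omega>"
  shows "column_kernel \<Omega> s x y = 2 ^ s *
    (\<Sum>(a, b)\<in>{a \<in> {..<s} \<rightarrow>\<^sub>E y. inj_on a {..<s}} \<times> {b \<in> {..<s} \<rightarrow>\<^sub>E \<Omega> - y. inj_on b {..<s}}. column_sign s a b x)"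
proof -
  let ?P = "column_pairs \<Omega> s"
  define H where "H = (\<lambda>ab :: (nat \<Rightarrow> 'a) \<times> (nat \<Rightarrow> 'a). \<forall>i<s. fst ab i \<in> y \<and> snd ab i \<notin> y)"
  define e where "e = (\<lambda>ab :: (nat \<Rightarrow> 'a) \<times> (nat \<Rightarrow> 'a). column_sign s (fst ab) (snd ab) x)"
  have "column_kernel \<Omega> s x y = (\<Sum>ab\<in>?P. \<Sum>J\<in>Pow {..<s}. e ab * ((-1) ^ card J * of_bool (H (column_swap J ab))))"
    unfolding column_kernel_def H_def e_def
    by (intro sum.cong refl, clarify, subst (2) column_sign_eq_sum_swap) (simp add: sum_distrib_left del: sum_mult_of_bool_eq)
  also have "\<dots> = (\<Sum>J\<in>Pow {..<s}. \<Sum>ab\<in>?P. e ab * ((-1) ^ card J * of_bool (H (column_swap J ab))))"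
    by (rule sum.swap)
  also have "\<dots> = (\<Sum>J\<in>Pow {..<s}. \<Sum>ab\<in>?P. e ab * of_bool (H ab))"
  proof (rule sum.cong[OF refl])
    \<comment> \<open>Swapping the columns in \<open>J\<close> is a bijection of the pairs, and the
      sign at \<open>x\<close>, left unexpanded, absorbs \<open>(-1) ^ card J\<close>. Hence all
      \<open>2 ^ s\<close> sets \<open>J\<close> contribute the same sum.\<close>
    fix J assume J: "J \<in> Pow {..<s}"
    have "(\<Sum>ab\<in>?P. e ab * ((-1) ^ card J * of_bool (H (column_swap J ab))))
      = (\<Sum>ab\<in>?P. e (column_swap J ab) * of_bool (H (column_swap J ab)))"
      using J by (intro sum.cong refl) (auto simp: e_def column_sign_column_swap split: prod.splits)
    also have "\<dots> = (\<Sum>ab\<in>?P. e ab * of_bool (H ab))"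
      using J by (intro sum.reindex_bij_witness[of _ "column_swap J" "column_swap J"])
        (auto simp: column_swap_involution column_swap_column_pairs)
    finally show "(\<Sum>ab\<in>?P. e ab * ((-1) ^ card J * of_bool (H (column_swap J ab)))) = (\<Sum>ab\<in>?P. e ab * of_bool (H ab))" .
  qed
  also have "\<dots> = 2 ^ s * (\<Sum>ab\<in>?P. e ab * of_bool (H ab))"
    by (simp add: card_Pow)
  also have "(\<Sum>ab\<in>?P. e ab * of_bool (H ab)) = (\<Sum>ab\<in>{ab \<in> ?P. H ab}. e ab)"
    using finite_column_pairs[OF fin] by (simp add: sum.inter_filter of_bool_def if_distrib cong: if_cong)
  also have "{ab \<in> ?P. H ab} = {a \<in> {..<s} \<rightarrow>\<^sub>E y. inj_on a {..<s}} \<times> {b \<in> {..<s} \<rightarrow>\<^sub>E \<Omega> - y. inj_on b {..<s}}"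
    using y by (auto simp: H_def column_pairs_def columns_def PiE_iff image_subset_iff) (metis lessThan_iff)
  finally show ?thesis by (simp add: e_def split_def)
qed

text \<open>A Hahn polynomial up to normalisation, in the variable \<open>t = card (x - y)\<close>.
  The index \<open>j\<close> is the number of columns whose bottom entry is required to lie in
  \<open>x\<close>. The factors count injective fillings: \<open>s - j\<close> top entries in both
  sets, \<open>j\<close> further ones anywhere in \<open>y\<close>, \<open>j\<close> bottom entries
  in \<open>x - y\<close>, and \<open>s - j\<close> further ones outside \<open>y\<close>. The two
  products are the falling factorials of \<open>r2 - t\<close> and of \<open>t\<close>.\<close>

definition hahn_poly :: "nat \<Rightarrow> nat \<Rightarrow> nat \<Rightarrow> nat \<Rightarrow> complex poly" where
  "hahn_poly n s r1 r2 = (\<Sum>j\<le>s. smult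
     ((-1) ^ j * of_nat ((s choose j) * ffact (r1 - (s - j)) j * ffact (n - r1 - j) (s - j)))
     ((\<Prod>i<s - j. [:of_nat r2 - of_nat i, -1:]) * (\<Prod>i<j. [:- of_nat i, 1:])))"

lemma poly_hahn_poly:
  assumes "k \<le> r2"
  shows "poly (hahn_poly n s r1 r2) (of_nat k) = (\<Sum>j\<le>s. of_nat (s choose j) * ((-1) ^ j *
    of_nat (ffact (r2 - k) (s - j) * ffact (r1 - (s - j)) j * (ffact k j * ffact (n - r1 - j) (s - j)))))"
  using assms unfolding hahn_poly_def poly_sum
  by (intro sum.cong refl) (simp add: poly_prod of_nat_ffact algebra_simps of_nat_diff)

text \<open>Once the set \<open>J\<close> of columns contributing their bottom entry is fixed, the
  conditions on \<open>a\<close> and \<open>b\<close> separate. The sum becomes a product of two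
  counts of injections with part of the image prescribed, and it depends on \<open>J\<close> only
  through \<open>card J\<close>.\<close>

lemma column_kernel_eq_poly:
  assumes fin: "finite \<Omega>" and x: "x \<in> Xr \<Omega> r2" and y: "y \<in> Xr \<Omega> r1"
  shows "column_kernel \<Omega> s x y = 2 ^ s * poly (hahn_poly (card \<Omega>) s r1 r2) (of_nat (card (x - y)))"
proof -
  let ?I = "{..<s}"
  let ?A = "{a \<in> ?I \<rightarrow>\<^sub>E y. inj_on a ?I}" and ?B = "{b \<in> ?I \<rightarrow>\<^sub>E \<Omega> - y. inj_on b ?I}"
  define k where "k = card (x - y)"
  have xy: "x \<subseteq> \<Omega>" "y \<subseteq> \<Omega>" "card x = r2" "card y = r1" "finite x" "finite y"
    using x y fin by (auto simp: Xr_def intro: finite_subset)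
  have k: "k \<le> r2" using xy by (auto simp: k_def intro: card_mono)
  have cyx: "card (y \<inter> x) = r2 - k"
    using xy card_Diff_subset_Int[of x y] card_mono[of x "x \<inter> y"] by (simp add: k_def Int_commute)
  have "finite (?I \<rightarrow>\<^sub>E y)" "finite (?I \<rightarrow>\<^sub>E \<Omega> - y)" using xy fin by (simp_all add: finite_PiE)
  then have fA: "finite ?A" "finite ?B" by simp_all
  have ind: "(\<Prod>i\<in>A. if P i then 1 else 0 :: complex) = of_bool (\<forall>i\<in>A. P i)" if "finite A" for A and P :: "nat \<Rightarrow> bool"
    using that by (induction A) auto
  have "(\<Sum>(a, b)\<in>?A \<times> ?B. column_sign s a b x)
    = (\<Sum>(a, b)\<in>?A \<times> ?B. \<Sum>J\<in>Pow ?I. (-1) ^ card J * of_bool (b ` J \<subseteq> x) * of_bool (a ` (?I - J) \<subseteq> x))"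
  proof (intro sum.cong refl, clarify)
    fix a b :: "nat \<Rightarrow> 'a"
    show "column_sign s a b x = (\<Sum>J\<in>Pow ?I. (-1) ^ card J * of_bool (b ` J \<subseteq> x) * of_bool (a ` (?I - J) \<subseteq> x))"
      unfolding column_sign_def
      by (subst prod_diff_conv_sum, simp, intro sum.cong refl, subst (1 2) ind)
         (auto intro: finite_subset simp: image_subset_iff)
  qed
  also have "\<dots> = (\<Sum>J\<in>Pow ?I. \<Sum>(a, b)\<in>?A \<times> ?B. (-1) ^ card J * of_bool (b ` J \<subseteq> x) * of_bool (a ` (?I - J) \<subseteq> x))"
    unfolding split_def by (rule sum.swap)
  also have "\<dots> = (\<Sum>J\<in>Pow ?I. (\<lambda>j. (-1) ^ j *
    of_nat (ffact (r2 - k) (s - j) * ffact (r1 - (s - j)) j * (ffact k j * ffact (card \<Omega> - r1 - j) (s - j)))) (card J))"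
  proof (intro sum.cong refl)
    fix J assume J: "J \<in> Pow ?I"
    then have "finite J" by (auto intro: finite_subset)
    with J have fJ: "finite J" "card J \<le> s" "card (?I - J) = s - card J"
      using card_mono[of ?I J] by (auto simp: card_Diff_subset)
    have "(\<Sum>(a, b)\<in>?A \<times> ?B. (-1) ^ card J * of_bool (b ` J \<subseteq> x) * of_bool (a ` (?I - J) \<subseteq> x) :: complex)
      = (-1) ^ card J * ((\<Sum>a\<in>?A. of_bool (a ` (?I - J) \<subseteq> x)) * (\<Sum>b\<in>?B. of_bool (b ` J \<subseteq> x)))"
      by (simp add: sum.cartesian_product[symmetric] sum_product sum_distrib_left mult_ac)
    also have "(\<Sum>a\<in>?A. of_bool (a ` (?I - J) \<subseteq> x) :: complex) = of_nat (card {a \<in> ?A. a ` (?I - J) \<subseteq> x})"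
      using fA by (simp add: sum.inter_filter[symmetric] of_bool_def)
    also have "{a \<in> ?A. a ` (?I - J) \<subseteq> x} = {a \<in> ?I \<rightarrow>\<^sub>E y. inj_on a ?I \<and> a ` (?I - J) \<subseteq> y \<inter> x}"
      by (auto simp: PiE_iff)
    also have "card \<dots> = ffact (r2 - k) (s - card J) * ffact (r1 - (s - card J)) (card J)"
      using xy fJ by (subst card_inj_PiE) (auto simp: cyx)
    also have "(\<Sum>b\<in>?B. of_bool (b ` J \<subseteq> x) :: complex) = of_nat (card {b \<in> ?B. b ` J \<subseteq> x})"
      using fA by (simp add: sum.inter_filter[symmetric] of_bool_def)
    also have "{b \<in> ?B. b ` J \<subseteq> x} = {b \<in> ?I \<rightarrow>\<^sub>E \<Omega> - y. inj_on b ?I \<and> b ` J \<subseteq> x - y}"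
      using J by (fastforce simp: PiE_iff)
    also have "card \<dots> = ffact k (card J) * ffact (card \<Omega> - r1 - card J) (s - card J)"
      using xy fJ fin J by (subst card_inj_PiE) (auto simp: k_def card_Diff_subset)
    finally show "(\<Sum>(a, b)\<in>?A \<times> ?B. (-1) ^ card J * of_bool (b ` J \<subseteq> x) * of_bool (a ` (?I - J) \<subseteq> x) :: complex)
      = (\<lambda>j. (-1) ^ j * of_nat (ffact (r2 - k) (s - j) * ffact (r1 - (s - j)) j *
          (ffact k j * ffact (card \<Omega> - r1 - j) (s - j)))) (card J)"
      by simp
  qed
  also have "\<dots> = poly (hahn_poly (card \<Omega>) s r1 r2) (of_nat k)"
    by (subst sum_Pow_card) (simp_all add: poly_hahn_poly[OF k])
  finally show ?thesis using xy fin by (subst column_kernel_eq_oriented_sum) (auto simp: k_def)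
qed

text \<open>At \<open>t = 0\<close> the factor \<open>ffact 0 j\<close> removes every term except
  \<open>j = 0\<close>.\<close>

lemma poly_hahn_poly_0:
  "poly (hahn_poly n s r1 r2) 0 = of_nat (ffact r2 s * ffact (n - r1) s)"
proof -
  have "poly (hahn_poly n s r1 r2) (of_nat 0) = (\<Sum>j\<in>{0}. of_nat (s choose j) * ((-1) ^ j *
    of_nat (ffact (r2 - 0) (s - j) * ffact (r1 - (s - j)) j * (ffact 0 j * ffact (n - r1 - j) (s - j)))))"
    by (subst poly_hahn_poly, simp, rule sum.mono_neutral_right) (auto simp: ffact_eq_0_iff)
  then show ?thesis by (simp add: ffact_def)
qed

text \<open>The sign \<open>(-1) ^ j\<close> meets a leading coefficient
  \<open>(-1) ^ (s - j)\<close>, so all top coefficients have the common sign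
  \<open>(-1) ^ s\<close> and cannot cancel; the one for \<open>j = s\<close> is nonzero.\<close>

lemma degree_hahn_poly:
  assumes "s \<le> r1" "s \<le> n - r1"
  shows "degree (hahn_poly n s r1 r2) = s"
proof -
  define q where "q = (\<lambda>j. (\<Prod>i<s - j. [:of_nat r2 - of_nat i, -1:]) * (\<Prod>i<j. [:- of_nat i, 1:]) :: complex poly)"
  define c where "c = (\<lambda>j. (s choose j) * ffact (r1 - (s - j)) j * ffact (n - r1 - j) (s - j))"
  have h: "hahn_poly n s r1 r2 = (\<Sum>j\<le>s. smult ((-1) ^ j * of_nat (c j)) (q j))"
    by (simp add: hahn_poly_def q_def c_def)
  have dq: "degree (q j) = s" and lq: "coeff (q j) s = (-1) ^ (s - j)" if "j \<le> s" for j
  proof -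
    have "degree (\<Prod>i<s - j. [:of_nat r2 - of_nat i, -1 :: complex:]) = s - j"
      by (subst degree_prod_eq_sum_degree) auto
    moreover have "degree (\<Prod>i<j. [:- of_nat i, 1 :: complex:]) = j"
      by (subst degree_prod_eq_sum_degree) auto
    ultimately show d: "degree (q j) = s"
      using that unfolding q_def by (subst degree_mult_eq) auto
    have "lead_coeff (q j) = (-1) ^ (s - j)"
      unfolding q_def lead_coeff_mult lead_coeff_prod by simp
    then show "coeff (q j) s = (-1) ^ (s - j)" by (simp add: d)
  qed
  have "coeff (hahn_poly n s r1 r2) s = (\<Sum>j\<le>s. (-1) ^ s * of_nat (c j))"
    unfolding h coeff_sum
    by (intro sum.cong refl) (simp add: lq power_add[symmetric])
  also have "\<dots> = (-1) ^ s * of_nat (\<Sum>j\<le>s. c j)"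
    by (simp add: sum_distrib_left)
  also have "(\<Sum>j\<le>s. c j) \<noteq> 0"
    using assms by (auto simp: c_def ffact_eq_0_iff intro!: exI[of _ s])
  then have "(-1) ^ s * of_nat (\<Sum>j\<le>s. c j) \<noteq> (0 :: complex)"
    by (simp del: of_nat_sum)
  finally have "s \<le> degree (hahn_poly n s r1 r2)" by (rule le_degree)
  moreover have "degree (hahn_poly n s r1 r2) \<le> s"
    unfolding h by (intro degree_sum_le) (auto simp: dq)
  ultimately show ?thesis by simp
qed

section \<open>Spaces spanned by polytabloids\<close>

definition polytab :: "'a set \<Rightarrow> nat \<Rightarrow> nat \<Rightarrow> (nat \<Rightarrow> 'a) \<Rightarrow> (nat \<Rightarrow> 'a) \<Rightarrow> 'a set \<Rightarrow> complex" where
  "polytab \<Omega> r s a b = (\<lambda>x. if x \<in> Xr \<Omega> r then column_sign s a b x else 0)"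

definition polytab_space :: "'a set \<Rightarrow> nat \<Rightarrow> nat \<Rightarrow> ('a set \<Rightarrow> complex) set" where
  "polytab_space \<Omega> r s = cspan {polytab \<Omega> r s a b | a b. columns \<Omega> s a b}"

lemma specht_eq_polytab_space: "specht \<Omega> s = polytab_space \<Omega> s s"
  unfolding specht_def polytab_space_def polytabloid_def polytab_def column_sign_def columns_iff ..

section \<open>Spans and their invariance under permutations\<close>

lemma csubspace_sum:
  assumes "csubspace V" "finite F" "\<And>g. g \<in> F \<Longrightarrow> f g \<in> V"
  shows "(\<lambda>x. \<Sum>g\<in>F. c g * f g x) \<in> V"
  using assms(2,3)
proof (induction F)
  case (insert g F)
  then have "(\<lambda>x. c g * f g x) \<in> V" "(\<lambda>x. \<Sum>g\<in>F. c g * f g x) \<in> V"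
    using assms(1) by (auto simp: csubspace_def)
  then have "(\<lambda>x. c g * f g x + (\<Sum>g\<in>F. c g * f g x)) \<in> V"
    using assms(1) by (auto simp: csubspace_def)
  then show ?case using insert by simp
qed (use assms(1) in \<open>simp add: csubspace_def\<close>)

lemma cspan_least: "csubspace V \<Longrightarrow> S \<subseteq> V \<Longrightarrow> cspan S \<subseteq> V"
  unfolding cspan_def by (auto intro!: csubspace_sum)

lemma cspan_superset: "S \<subseteq> cspan S"
proof
  fix f assume "f \<in> S"
  then show "f \<in> cspan S"
    unfolding cspan_def by (auto intro!: exI[of _ "{f}"] exI[of _ "\<lambda>_. 1"])
qed

lemma cspanI: "finite F \<Longrightarrow> F \<subseteq> S \<Longrightarrow> (\<lambda>x. \<Sum>g\<in>F. c g * g x) \<in> cspan S"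
  unfolding cspan_def by blast

lemma cspanE:
  assumes "f \<in> cspan S"
  obtains F c where "finite F" "F \<subseteq> S" "f = (\<lambda>x. \<Sum>g\<in>F. c g * g x)"
  using assms unfolding cspan_def mem_Collect_eq by (elim exE conjE) (rule that)

lemma csubspace_cspan: "csubspace (cspan S)"
  unfolding csubspace_def
proof (intro conjI ballI allI)
  show "(\<lambda>_. 0) \<in> cspan S" unfolding cspan_def by (auto intro!: exI[of _ "{}"])
next
  fix f g assume fg: "f \<in> cspan S" "g \<in> cspan S"
  obtain F c G d where F: "finite F" "F \<subseteq> S" "f = (\<lambda>x. \<Sum>h\<in>F. c h * h x)"
    and G: "finite G" "G \<subseteq> S" "g = (\<lambda>x. \<Sum>h\<in>G. d h * h x)"
    by (rule cspanE[OF fg(1)], rule cspanE[OF fg(2)]) (rule that)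
  have "(\<lambda>x. f x + g x) = (\<lambda>x. \<Sum>h\<in>F \<union> G. ((if h \<in> F then c h else 0) + (if h \<in> G then d h else 0)) * h x)"
  proof
    fix x
    have "(\<Sum>h\<in>F. c h * h x) = (\<Sum>h\<in>F \<union> G. (if h \<in> F then c h else 0) * h x)"
      using F(1) G(1) by (intro sum.mono_neutral_cong_left) auto
    moreover have "(\<Sum>h\<in>G. d h * h x) = (\<Sum>h\<in>F \<union> G. (if h \<in> G then d h else 0) * h x)"
      using F(1) G(1) by (intro sum.mono_neutral_cong_left) auto
    ultimately show "f x + g x = (\<Sum>h\<in>F \<union> G. ((if h \<in> F then c h else 0) + (if h \<in> G then d h else 0)) * h x)"
      by (simp add: F(3) G(3) distrib_right sum.distrib)
  qed
  then show "(\<lambda>x. f x + g x) \<in> cspan S"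
    by (rule ssubst) (rule cspanI, use F(1,2) G(1,2) in auto)
next
  fix k f assume "f \<in> cspan S"
  then obtain F c where F: "finite F" "F \<subseteq> S" "f = (\<lambda>x. \<Sum>h\<in>F. c h * h x)"
    by (rule cspanE)
  have "(\<lambda>x. \<Sum>h\<in>F. (k * c h) * h x) \<in> cspan S" by (rule cspanI[OF F(1,2), of "\<lambda>h. k * c h"])
  then show "(\<lambda>x. k * f x) \<in> cspan S" by (simp add: F(3) sum_distrib_left mult.assoc)
qed

lemma polytab_in_polytab_space: "columns \<Omega> s a b \<Longrightarrow> polytab \<Omega> r s a b \<in> polytab_space \<Omega> r s"
  unfolding polytab_space_def by (rule subsetD[OF cspan_superset]) (rule CollectI, rule exI[of _ a], rule exI[of _ b], simp)

lemma csubspace_polytab_space: "csubspace (polytab_space \<Omega> r s)"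
  unfolding polytab_space_def by (rule csubspace_cspan)

text \<open>Serves as an induction principle: a linear condition on functions need only be checked
  on the generators.\<close>

lemma polytab_space_least:
  assumes "csubspace V" "\<And>a b. columns \<Omega> s a b \<Longrightarrow> polytab \<Omega> r s a b \<in> V"
  shows "polytab_space \<Omega> r s \<subseteq> V"
  unfolding polytab_space_def using assms by (intro cspan_least) auto

lemma csubspace_L2Xr: "csubspace (L2Xr \<Omega> r)"
  by (auto simp: csubspace_def L2Xr_def)

lemma polytab_space_subset_L2Xr: "polytab_space \<Omega> r s \<subseteq> L2Xr \<Omega> r"
  by (rule polytab_space_least[OF csubspace_L2Xr]) (simp add: L2Xr_def polytab_def)

lemma permutes_image_Xr:
  assumes "g permutes \<Omega>"
  shows "g ` x \<in> Xr \<Omega> r \<longleftrightarrow> x \<in> Xr \<Omega> r"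
proof -
  have "inj g" using assms by (rule permutes_inj)
  moreover have "g ` x \<subseteq> \<Omega> \<longleftrightarrow> x \<subseteq> \<Omega>"
    by (metis assms \<open>inj g\<close> inj_image_subset_iff permutes_image)
  ultimately show ?thesis by (simp add: Xr_def card_image inj_on_subset)
qed

lemma act_polytab:
  assumes "g permutes \<Omega>"
  shows "act g (polytab \<Omega> r s a b) = polytab \<Omega> r s (g \<circ> a) (g \<circ> b)"
  using permutes_bij[OF assms]
  by (simp add: act_def polytab_def fun_eq_iff column_sign_inv_image permutes_image_Xr[OF permutes_inv[OF assms]])

lemma columns_permutes:
  assumes "columns \<Omega> s a b" "g permutes \<Omega>"
  shows "columns \<Omega> s (g \<circ> a) (g \<circ> b)"
  by (rule columnsI)
     (use columnsD[OF assms(1)] permutes_in_image[OF assms(2)] permutes_inj[OF assms(2)] in \<open>auto simp: inj_eq\<close>)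

lemma G_subspace_polytab_space: "G_subspace \<Omega> (polytab_space \<Omega> r s)"
  unfolding G_subspace_def G_invariant_def
proof (intro conjI allI impI ballI)
  show sub: "csubspace (polytab_space \<Omega> r s)" by (rule csubspace_polytab_space)
  fix g f assume g: "g permutes \<Omega>" and f: "f \<in> polytab_space \<Omega> r s"
  have "polytab_space \<Omega> r s \<subseteq> {f. act g f \<in> polytab_space \<Omega> r s}"
  proof (rule polytab_space_least)
    show "csubspace {f. act g f \<in> polytab_space \<Omega> r s}"
      using sub by (simp add: csubspace_def act_def)
  qed (simp add: act_polytab[OF g] polytab_in_polytab_space columns_permutes g)
  then show "act g f \<in> polytab_space \<Omega> r s" using f by blast
qed

lemma transpose_permutes: "columns \<Omega> s a b \<Longrightarrow> i < s \<Longrightarrow> transpose (a i) (b i) permutes \<Omega>"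
  by (rule permutes_swap_id) (auto dest: columnsD)

lemma act_transpose_polytab:
  assumes "columns \<Omega> s a b" "i < s"
  shows "act (transpose (a i) (b i)) (polytab \<Omega> r s a b) = (\<lambda>x. - polytab \<Omega> r s a b x)"
  by (simp add: act_def polytab_def fun_eq_iff column_sign_transpose[OF assms] transpose_mem_Xr[OF assms])

lemma polytab_cong:
  assumes "\<And>i. i < s \<Longrightarrow> a i = a' i" "\<And>i. i < s \<Longrightarrow> b i = b' i"
  shows "polytab \<Omega> r s a b = polytab \<Omega> r s a' b'"
  unfolding polytab_def using assms by (intro ext if_cong column_sign_cong refl) auto

section \<open>Transitivity on columns and rigidity of antisymmetric functions\<close>

lemma permutes_extension:
  assumes fin: "finite \<Omega>" and A: "A \<subseteq> \<Omega>" "inj_on f A" "f ` A \<subseteq> \<Omega>"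
  obtains g where "g permutes \<Omega>" "\<And>x. x \<in> A \<Longrightarrow> g x = f x"
proof -
  have fA: "finite A" using fin A finite_subset by blast
  have "card (\<Omega> - A) = card (\<Omega> - f ` A)"
    using fA A by (simp add: card_Diff_subset card_image)
  then obtain h where h: "bij_betw h (\<Omega> - A) (\<Omega> - f ` A)"
    using fin by (metis finite_Diff finite_same_card_bij)
  define g where "g = (\<lambda>x. if x \<in> A then f x else if x \<in> \<Omega> then h x else x)"
  have "bij_betw g A (f ` A)"
    using A(2) by (subst bij_betw_cong[of _ _ f]) (auto simp: g_def bij_betw_def)
  moreover have "bij_betw g (\<Omega> - A) (\<Omega> - f ` A)"
    using h by (subst bij_betw_cong[of _ _ h]) (auto simp: g_def)
  ultimately have "bij_betw g (A \<union> (\<Omega> - A)) (f ` A \<union> (\<Omega> - f ` A))"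
    by (rule bij_betw_combine) auto
  then have "bij_betw g \<Omega> \<Omega>" using A by (simp add: Un_absorb1)
  then have "g permutes \<Omega>" by (rule bij_imp_permutes) (use A(1) in \<open>auto simp: g_def\<close>)
  then show ?thesis using that by (simp add: g_def)
qed

lemma columns_transitive:
  assumes fin: "finite \<Omega>" and col: "columns \<Omega> s a b" "columns \<Omega> s a' b'"
  obtains g where "g permutes \<Omega>" "\<And>i. i < s \<Longrightarrow> g (a i) = a' i" "\<And>i. i < s \<Longrightarrow> g (b i) = b' i"
proof -
  let ?I = "{..<s}"
  define f where "f = (\<lambda>x. if x \<in> a ` ?I then a' (inv_into ?I a x) else b' (inv_into ?I b x))"
  have inj: "inj_on a ?I" "inj_on b ?I" using col(1) by (auto simp: columns_def)
  have fa: "f (a i) = a' i" if "i < s" for i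
    using that inj by (simp add: f_def)
  have fb: "f (b i) = b' i" if "i < s" for i
    using that inj columnsD(6)[OF col(1)] by (auto simp: f_def)
  have "inj_on f (a ` ?I \<union> b ` ?I)"
    by (rule inj_onI) (use columnsD[OF col(2)] in \<open>auto simp: fa fb\<close>)
  moreover have "f ` (a ` ?I \<union> b ` ?I) \<subseteq> \<Omega>" "a ` ?I \<union> b ` ?I \<subseteq> \<Omega>"
    using columnsD[OF col(2)] columnsD[OF col(1)] by (auto simp: fa fb)
  ultimately obtain g where "g permutes \<Omega>" "\<And>x. x \<in> a ` ?I \<union> b ` ?I \<Longrightarrow> g x = f x"
    using permutes_extension[OF fin] by metis
  then show ?thesis using that fa fb by simp
qed

text \<open>A set containing none or both entries of a column is fixed by its transposition, so
  \<open>h\<close> vanishes there. Swaps carry any other set in \<open>Xr \<Omega> r\<close> to all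
  the top entries together with a set \<open>R\<close> outside the columns, and \<open>const\<close>
  makes the value there a single number. For \<open>r = s\<close> only the empty \<open>R\<close>
  remains and \<open>const\<close> is automatic.\<close>

lemma antisymmetric_eq_scaled_polytab:
  assumes fin: "finite \<Omega>" and col: "columns \<Omega> s a b" and h: "h \<in> L2Xr \<Omega> r"
    and anti: "\<And>i. i < s \<Longrightarrow> act (transpose (a i) (b i)) h = (\<lambda>x. - h x)"
    and const: "\<And>R R'. R \<subseteq> \<Omega> - (a ` {..<s} \<union> b ` {..<s}) \<Longrightarrow> R' \<subseteq> \<Omega> - (a ` {..<s} \<union> b ` {..<s}) \<Longrightarrow>
      card R = r - s \<Longrightarrow> card R' = r - s \<Longrightarrow> h (a ` {..<s} \<union> R) = h (a ` {..<s} \<union> R')"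
  shows "\<exists>c. h = (\<lambda>x. c * polytab \<Omega> r s a b x)"
proof -
  define C where "C = a ` {..<s} \<union> b ` {..<s}"
  have flip: "h (transpose (a i) (b i) ` x) = - h x" if "i < s" for i x
    using fun_cong[OF anti[OF that], of x] by (simp add: act_def)
  define P where "P = (\<lambda>R. R \<subseteq> \<Omega> - C \<and> card R = r - s)"
  \<comment> \<open>If no \<open>R\<close> satisfies \<open>P\<close>, this value is arbitrary and
    \<open>base\<close> is vacuous.\<close>
  define c where "c = h (a ` {..<s} \<union> (SOME R. P R))"
  have base: "h (a ` {..<s} \<union> R) = c" if "P R" for R
    using someI[of P, OF that] that const[folded C_def] by (simp add: c_def P_def)
  have main: "h x = column_sign s a b x * c"
    if "x \<in> Xr \<Omega> r" "\<And>i. i < s \<Longrightarrow> (a i \<in> x) \<noteq> (b i \<in> x)" for x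
    using that
  \<comment> \<open>Swapping a column whose bottom entry lies in \<open>x\<close> lowers the number
    of such columns by one and negates both sides of the claim.\<close>
  proof (induction "card {i. i < s \<and> b i \<in> x}" arbitrary: x rule: less_induct)
    case less
    show ?case
    proof (cases "\<exists>i<s. b i \<in> x")
      case False
      then have x: "a i \<in> x" "b i \<notin> x" if "i < s" for i using less.prems that by auto
      have fx: "finite x" "card x = r" "x \<subseteq> \<Omega>" using less.prems(1) fin by (auto simp: Xr_def intro: finite_subset)
      have xC: "x \<inter> C = a ` {..<s}" using x by (auto simp: C_def)
      have "card (x \<inter> C) = s" using card_transversal[OF col less.prems(2)] by (simp add: C_def)
      then have "card (x - C) = r - s" using fx by (simp add: card_Diff_subset_Int)
      then have "P (x - C)" using fx by (auto simp: P_def)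
      from base[OF this] have "h x = c" unfolding xC[symmetric] by (simp add: Un_commute Un_Diff_Int)
      moreover have "column_sign s a b x = 1" using x by (simp add: column_sign_def)
      ultimately show ?thesis by simp
    next
      case True
      then obtain i where i: "i < s" "b i \<in> x" by blast
      then have ai: "a i \<notin> x" using less.prems by blast
      let ?y = "transpose (a i) (b i) ` x"
      have mem: "a j \<in> ?y \<longleftrightarrow> (if j = i then b i \<in> x else a j \<in> x)"
        "b j \<in> ?y \<longleftrightarrow> (if j = i then a i \<in> x else b j \<in> x)" if "j < s" for j
        using that i columnsD[OF col] by (auto simp: in_transpose_image_iff)
      have "{j. j < s \<and> b j \<in> ?y} = {j. j < s \<and> b j \<in> x} - {i}"
        using ai by (simp add: mem set_eq_iff cong: conj_cong)
      then have "card {j. j < s \<and> b j \<in> ?y} < card {j. j < s \<and> b j \<in> x}"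
        using i by (simp only:) (rule card_Diff1_less, auto)
      then have "h ?y = column_sign s a b ?y * c"
        using less.prems i mem by (intro less.hyps) (auto simp: transpose_mem_Xr[OF col i(1)])
      then show ?thesis by (simp add: flip[OF i(1)] column_sign_transpose[OF col i(1)])
    qed
  qed
  have "h x = c * polytab \<Omega> r s a b x" for x
  proof (cases "x \<in> Xr \<Omega> r")
    case True
    show ?thesis
    proof (cases "\<exists>i<s. a i \<in> x \<longleftrightarrow> b i \<in> x")
      case T: True
      then obtain i where i: "i < s" "a i \<in> x \<longleftrightarrow> b i \<in> x" by blast
      then have "h x = 0" using flip[OF i(1), of x] by simp
      then show ?thesis using T by (simp add: polytab_def column_sign_eq_0_iff[THEN iffD2])
    next
      case False
      then show ?thesis using main[OF True] True by (simp add: polytab_def)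
    qed
  next
    case False
    then show ?thesis using h by (simp add: L2Xr_def polytab_def)
  qed
  then show ?thesis by blast
qed

text \<open>Invariance under the pointwise stabiliser of the columns yields \<open>const\<close>:
  \<open>R\<close> and \<open>R'\<close> have equal size and avoid the columns, so some stabilising
  permutation carries one to the other. Both symmetry hypotheses pass to the image of a polytabloid
  under any equivariant linear map.\<close>

lemma equivariant_eq_scaled_polytab:
  assumes fin: "finite \<Omega>" and col: "columns \<Omega> s a b" and h: "h \<in> L2Xr \<Omega> r"
    and anti: "\<And>i. i < s \<Longrightarrow> act (transpose (a i) (b i)) h = (\<lambda>x. - h x)"
    and stab: "\<And>g. g permutes \<Omega> \<Longrightarrow> (\<And>i. i < s \<Longrightarrow> g (a i) = a i \<and> g (b i) = b i) \<Longrightarrow> act g h = h"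
  shows "\<exists>c. h = (\<lambda>x. c * polytab \<Omega> r s a b x)"
proof (rule antisymmetric_eq_scaled_polytab[OF fin col h anti])
  define C where "C = a ` {..<s} \<union> b ` {..<s}"
  fix R R' assume "R \<subseteq> \<Omega> - (a ` {..<s} \<union> b ` {..<s})" "R' \<subseteq> \<Omega> - (a ` {..<s} \<union> b ` {..<s})"
    and cR: "card R = r - s" "card R' = r - s"
  then have R: "R \<subseteq> \<Omega> - C" "R' \<subseteq> \<Omega> - C" by (simp_all add: C_def)
  then have "finite R" "finite R'" using fin by (auto intro: finite_subset)
  then obtain f where f: "bij_betw f R R'" using cR by (metis finite_same_card_bij)
  \<comment> \<open>\<open>R\<close> and \<open>R'\<close> may overlap, so \<open>k\<close> need not
    be injective on \<open>\<Omega>\<close>. Only its restriction to \<open>C \<union> R\<close> is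
    extended, and that is injective because \<open>R'\<close> avoids \<open>C\<close>.\<close>
  define k where "k = (\<lambda>x. if x \<in> R then f x else x)"
  have kR: "k ` R = R'" using f by (auto simp: k_def bij_betw_def)
  have kC: "k x = x" if "x \<in> C" for x using that R by (auto simp: k_def)
  have "inj_on k (C \<union> R)"
  proof (subst inj_on_Un, intro conjI)
    show "inj_on k C" by (simp add: inj_on_def kC)
    show "inj_on k R" using f by (auto simp: inj_on_def k_def bij_betw_def)
    have "k ` (C - R) \<subseteq> C" by (auto simp: kC)
    moreover have "k ` (R - C) \<subseteq> R'" using kR by blast
    ultimately show "k ` (C - R) \<inter> k ` (R - C) = {}" using R by blast
  qed
  moreover have C: "C \<subseteq> \<Omega>" using columnsD[OF col] by (auto simp: C_def)
  have "k ` C = C" by (simp add: kC cong: image_cong)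
  then have "k ` (C \<union> R) \<subseteq> \<Omega>" unfolding image_Un kR using R C by blast
  moreover have "C \<union> R \<subseteq> \<Omega>" using R C by blast
  ultimately obtain g where g: "g permutes \<Omega>" "\<And>x. x \<in> C \<union> R \<Longrightarrow> g x = k x"
    using permutes_extension[OF fin] by metis
  have "act g h = h" using g kC by (intro stab) (auto simp: C_def)
  then have "h (g ` (a ` {..<s} \<union> R)) = h (inv g ` g ` (a ` {..<s} \<union> R))"
    by (metis act_def)
  also have "inv g ` g ` (a ` {..<s} \<union> R) = a ` {..<s} \<union> R"
    using permutes_inj[OF g(1)] by (simp add: image_inv_f_f)
  also have "g ` (a ` {..<s} \<union> R) = a ` {..<s} \<union> R'"
  proof -
    have "g ` a ` {..<s} = a ` {..<s}" using g(2) kC by (simp add: C_def image_image cong: image_cong)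
    moreover have "g ` R = k ` R" using g(2) by (intro image_cong) auto
    ultimately show ?thesis using kR by (simp add: image_Un)
  qed
  finally show "h (a ` {..<s} \<union> R) = h (a ` {..<s} \<union> R')" by simp
qed

section \<open>The irreducible constituents\<close>

text \<open>With its adjoint \<open>down_map\<close>, the Radon transform for inclusion of subsets.
  For \<open>s \<le> r\<close> both composites act on the polytabloid spaces as multiplication by
  \<open>(card \<Omega> - 2 * s) choose (r - s)\<close>.\<close>

definition up_map :: "'a set \<Rightarrow> nat \<Rightarrow> nat \<Rightarrow> ('a set \<Rightarrow> complex) \<Rightarrow> 'a set \<Rightarrow> complex" where
  "up_map \<Omega> s r f = (\<lambda>x. if x \<in> Xr \<Omega> r then \<Sum>y | y \<in> Xr \<Omega> s \<and> y \<subseteq> x. f y else 0)"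

definition down_map :: "'a set \<Rightarrow> nat \<Rightarrow> nat \<Rightarrow> ('a set \<Rightarrow> complex) \<Rightarrow> 'a set \<Rightarrow> complex" where
  "down_map \<Omega> s r f = (\<lambda>y. if y \<in> Xr \<Omega> s then \<Sum>x | x \<in> Xr \<Omega> r \<and> y \<subseteq> x. f x else 0)"

lemma up_map_linear:
  "up_map \<Omega> s r (\<lambda>x. 0) = (\<lambda>x. 0)"
  "up_map \<Omega> s r (\<lambda>x. f x + g x) = (\<lambda>x. up_map \<Omega> s r f x + up_map \<Omega> s r g x)"
  "up_map \<Omega> s r (\<lambda>x. c * f x) = (\<lambda>x. c * up_map \<Omega> s r f x)"
  by (simp_all add: up_map_def fun_eq_iff sum.distrib sum_distrib_left)

lemma down_map_linear:
  "down_map \<Omega> s r (\<lambda>x. 0) = (\<lambda>x. 0)"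
  "down_map \<Omega> s r (\<lambda>x. f x + g x) = (\<lambda>x. down_map \<Omega> s r f x + down_map \<Omega> s r g x)"
  "down_map \<Omega> s r (\<lambda>x. c * f x) = (\<lambda>x. c * down_map \<Omega> s r f x)"
  by (simp_all add: down_map_def fun_eq_iff sum.distrib sum_distrib_left)

lemma up_map_polytab:
  assumes "finite \<Omega>" "columns \<Omega> s a b"
  shows "up_map \<Omega> s r (polytab \<Omega> s s a b) = polytab \<Omega> r s a b"
proof
  fix x
  have "(\<Sum>y | y \<in> Xr \<Omega> s \<and> y \<subseteq> x. polytab \<Omega> s s a b y) = (\<Sum>y | y \<in> Xr \<Omega> s \<and> y \<subseteq> x. column_sign s a b y)"
    by (intro sum.cong) (auto simp: polytab_def)
  then show "up_map \<Omega> s r (polytab \<Omega> s s a b) x = polytab \<Omega> r s a b x"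
    using column_sign_eq_sum_subsets[OF assms, of x] by (simp add: up_map_def polytab_def Xr_def)
qed

lemma down_map_polytab:
  assumes "finite \<Omega>" "columns \<Omega> s a b" "s \<le> r"
  shows "down_map \<Omega> s r (polytab \<Omega> r s a b)
    = (\<lambda>y. of_nat ((card \<Omega> - 2 * s) choose (r - s)) * polytab \<Omega> s s a b y)"
proof
  fix y
  have "(\<Sum>x | x \<in> Xr \<Omega> r \<and> y \<subseteq> x. polytab \<Omega> r s a b x) = (\<Sum>x | x \<in> Xr \<Omega> r \<and> y \<subseteq> x. column_sign s a b x)"
    by (intro sum.cong) (auto simp: polytab_def)
  then show "down_map \<Omega> s r (polytab \<Omega> r s a b) y
    = of_nat ((card \<Omega> - 2 * s) choose (r - s)) * polytab \<Omega> s s a b y"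
    using sum_column_sign_supersets[OF assms(1,2) _ assms(3), of y] by (simp add: down_map_def polytab_def)
qed

lemma up_map_polytab_space:
  assumes fin: "finite \<Omega>" and f: "f \<in> polytab_space \<Omega> s s"
  shows "up_map \<Omega> s r f \<in> polytab_space \<Omega> r s"
proof -
  have "polytab_space \<Omega> s s \<subseteq> {f. up_map \<Omega> s r f \<in> polytab_space \<Omega> r s}"
  proof (rule polytab_space_least)
    show "csubspace {f. up_map \<Omega> s r f \<in> polytab_space \<Omega> r s}"
      using csubspace_polytab_space[of \<Omega> r s] by (simp add: csubspace_def up_map_linear)
  qed (simp add: up_map_polytab[OF fin] polytab_in_polytab_space)
  then show ?thesis using f by blast
qed

lemma down_map_polytab_space:
  assumes fin: "finite \<Omega>" and f: "f \<in> polytab_space \<Omega> r s" and "s \<le> r"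
  shows "down_map \<Omega> s r f \<in> polytab_space \<Omega> s s"
proof -
  have sub: "csubspace (polytab_space \<Omega> s s)" by (rule csubspace_polytab_space)
  have "polytab_space \<Omega> r s \<subseteq> {f. down_map \<Omega> s r f \<in> polytab_space \<Omega> s s}"
  proof (rule polytab_space_least)
    show "csubspace {f. down_map \<Omega> s r f \<in> polytab_space \<Omega> s s}"
      using sub by (simp add: csubspace_def down_map_linear)
    fix a b assume col: "columns \<Omega> s a b"
    have "polytab \<Omega> s s a b \<in> polytab_space \<Omega> s s" by (rule polytab_in_polytab_space[OF col])
    then show "polytab \<Omega> r s a b \<in> {f. down_map \<Omega> s r f \<in> polytab_space \<Omega> s s}"
      using sub by (simp add: down_map_polytab[OF fin col \<open>s \<le> r\<close>] csubspace_def)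
  qed
  then show ?thesis using f by blast
qed

lemma up_down_map:
  assumes fin: "finite \<Omega>" and f: "f \<in> polytab_space \<Omega> r s" and "s \<le> r"
  shows "up_map \<Omega> s r (down_map \<Omega> s r f) = (\<lambda>x. of_nat ((card \<Omega> - 2 * s) choose (r - s)) * f x)"
proof -
  let ?c = "of_nat ((card \<Omega> - 2 * s) choose (r - s)) :: complex"
  have "polytab_space \<Omega> r s \<subseteq> {f. up_map \<Omega> s r (down_map \<Omega> s r f) = (\<lambda>x. ?c * f x)}"
  proof (rule polytab_space_least)
    show "csubspace {f. up_map \<Omega> s r (down_map \<Omega> s r f) = (\<lambda>x. ?c * f x)}"
      by (simp add: csubspace_def up_map_linear down_map_linear algebra_simps)
  qed (simp add: down_map_polytab[OF fin _ \<open>s \<le> r\<close>] up_map_polytab[OF fin] up_map_linear)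
  then show ?thesis using f by blast
qed

lemma down_up_map:
  assumes fin: "finite \<Omega>" and f: "f \<in> polytab_space \<Omega> s s" and "s \<le> r"
  shows "down_map \<Omega> s r (up_map \<Omega> s r f) = (\<lambda>x. of_nat ((card \<Omega> - 2 * s) choose (r - s)) * f x)"
proof -
  let ?c = "of_nat ((card \<Omega> - 2 * s) choose (r - s)) :: complex"
  have "polytab_space \<Omega> s s \<subseteq> {f. down_map \<Omega> s r (up_map \<Omega> s r f) = (\<lambda>x. ?c * f x)}"
  proof (rule polytab_space_least)
    show "csubspace {f. down_map \<Omega> s r (up_map \<Omega> s r f) = (\<lambda>x. ?c * f x)}"
      by (simp add: csubspace_def up_map_linear down_map_linear algebra_simps)
  qed (simp add: down_map_polytab[OF fin _ \<open>s \<le> r\<close>] up_map_polytab[OF fin])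
  then show ?thesis using f by blast
qed

lemma up_map_act:
  assumes fin: "finite \<Omega>" and f: "f \<in> polytab_space \<Omega> s s" and g: "g permutes \<Omega>"
  shows "up_map \<Omega> s r (act g f) = act g (up_map \<Omega> s r f)"
proof -
  have "polytab_space \<Omega> s s \<subseteq> {f. up_map \<Omega> s r (act g f) = act g (up_map \<Omega> s r f)}"
  proof (rule polytab_space_least)
    show "csubspace {f. up_map \<Omega> s r (act g f) = act g (up_map \<Omega> s r f)}"
      by (simp add: csubspace_def act_def up_map_linear)
  qed (simp add: act_polytab[OF g] up_map_polytab[OF fin] columns_permutes g)
  then show ?thesis using f by blast
qed

lemma down_map_act:
  assumes fin: "finite \<Omega>" and f: "f \<in> polytab_space \<Omega> r s" and g: "g permutes \<Omega>" and "s \<le> r"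
  shows "down_map \<Omega> s r (act g f) = act g (down_map \<Omega> s r f)"
proof -
  have "polytab_space \<Omega> r s \<subseteq> {f. down_map \<Omega> s r (act g f) = act g (down_map \<Omega> s r f)}"
  proof (rule polytab_space_least)
    show "csubspace {f. down_map \<Omega> s r (act g f) = act g (down_map \<Omega> s r f)}"
      by (simp add: csubspace_def act_def down_map_linear)
    fix a b assume col: "columns \<Omega> s a b"
    have "act g (\<lambda>y. c * h y) = (\<lambda>y. c * act g h y)" for c h by (simp add: act_def)
    then show "polytab \<Omega> r s a b \<in> {f. down_map \<Omega> s r (act g f) = act g (down_map \<Omega> s r f)}"
      by (simp add: act_polytab[OF g] down_map_polytab[OF fin _ \<open>s \<le> r\<close>] columns_permutes[OF col g] col)
  qed
  then show ?thesis using f by blast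
qed

section \<open>Irreducibility and identification with the Specht module\<close>

lemma exists_columns:
  assumes "finite \<Omega>" "2 * s \<le> card \<Omega>"
  obtains a b where "columns \<Omega> s a b"
proof -
  obtain f where f: "inj_on f {..<2 * s}" "f ` {..<2 * s} \<subseteq> \<Omega>"
    using assms by (metis card_le_inj card_lessThan finite_lessThan)
  have "columns \<Omega> s f (\<lambda>i. f (s + i))"
  proof (rule columnsI)
    show "f i \<noteq> f (s + j)" if "i < s" "j < s" for i j
      using inj_onD[OF f(1), of i "s + j"] that by auto
    show "i = j" if "i < s" "j < s" "f (s + i) = f (s + j)" for i j
      using inj_onD[OF f(1) that(3)] that(1,2) by auto
  qed (use f in \<open>auto simp: inj_on_def\<close>)
  then show ?thesis by (rule that)
qed

lemma polytab_same_neq_0: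
  assumes "columns \<Omega> s a b"
  shows "polytab \<Omega> s s a b \<noteq> (\<lambda>_. 0)"
proof -
  have "a ` {..<s} \<in> Xr \<Omega> s" using assms by (auto simp: Xr_def columns_def card_image)
  moreover have "column_sign s a b (a ` {..<s}) = 1"
    using columnsD[OF assms] unfolding column_sign_def by (intro prod.neutral) auto
  ultimately have "polytab \<Omega> s s a b (a ` {..<s}) = 1" by (simp add: polytab_def)
  then show ?thesis by (metis zero_neq_one)
qed

text \<open>\<open>down_map\<close> sends it to a multiple of the nonzero polytabloid at level
  \<open>s\<close>; the factor is nonzero because \<open>r + s \<le> card \<Omega>\<close> says that
  \<open>r - s \<le> card \<Omega> - 2 * s\<close>.\<close>

lemma polytab_neq_0:
  assumes "finite \<Omega>" "columns \<Omega> s a b" "s \<le> r" "r + s \<le> card \<Omega>"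
  shows "polytab \<Omega> r s a b \<noteq> (\<lambda>_. 0)"
proof
  assume "polytab \<Omega> r s a b = (\<lambda>_. 0)"
  then have "(\<lambda>y. of_nat ((card \<Omega> - 2 * s) choose (r - s)) * polytab \<Omega> s s a b y) = (\<lambda>_. 0 :: complex)"
    using down_map_polytab[OF assms(1-3)] by (simp add: down_map_linear)
  moreover have "(card \<Omega> - 2 * s) choose (r - s) \<noteq> 0" using assms(3,4) by (simp add: binomial_eq_0_iff)
  ultimately show False using polytab_same_neq_0[OF assms(2)] by (simp add: fun_eq_iff)
qed

lemma G_subspace_closed:
  assumes "G_subspace \<Omega> W"
  shows "f \<in> W \<Longrightarrow> h \<in> W \<Longrightarrow> (\<lambda>x. f x + h x) \<in> W" "f \<in> W \<Longrightarrow> (\<lambda>x. c * f x) \<in> W"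
    "f \<in> W \<Longrightarrow> h \<in> W \<Longrightarrow> (\<lambda>x. f x - h x) \<in> W" "g permutes \<Omega> \<Longrightarrow> f \<in> W \<Longrightarrow> act g f \<in> W" "(\<lambda>_. 0) \<in> W"
proof -
  have W: "\<And>f h. f \<in> W \<Longrightarrow> h \<in> W \<Longrightarrow> (\<lambda>x. f x + h x) \<in> W" "\<And>c f. f \<in> W \<Longrightarrow> (\<lambda>x. c * f x) \<in> W"
    using assms by (auto simp: G_subspace_def csubspace_def)
  then show "f \<in> W \<Longrightarrow> h \<in> W \<Longrightarrow> (\<lambda>x. f x + h x) \<in> W" "f \<in> W \<Longrightarrow> (\<lambda>x. c * f x) \<in> W" by blast+
  show "f \<in> W \<Longrightarrow> h \<in> W \<Longrightarrow> (\<lambda>x. f x - h x) \<in> W"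
    using W(1)[of f "\<lambda>x. - 1 * h x"] W(2)[of h "- 1"] by simp
  show "g permutes \<Omega> \<Longrightarrow> f \<in> W \<Longrightarrow> act g f \<in> W" "(\<lambda>_. 0) \<in> W"
    using assms by (auto simp: G_subspace_def G_invariant_def csubspace_def)
qed

text \<open>Antisymmetrising along the columns turns any \<open>f\<close> that is not orthogonal to a polytabloid
  into a nonzero multiple of it.\<close>

lemma polytab_in_G_subspace:
  assumes fin: "finite \<Omega>" and col: "columns \<Omega> s a b"
    and W: "G_subspace \<Omega> W" "W \<subseteq> L2Xr \<Omega> s"
    and f: "f \<in> W" "(\<Sum>x\<in>Xr \<Omega> s. f x * column_sign s a b x) \<noteq> 0"
  shows "polytab \<Omega> s s a b \<in> W"
proof -
  let ?t = "\<lambda>i. transpose (a i) (b i)"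
  let ?ip = "\<lambda>f. \<Sum>x\<in>Xr \<Omega> s. f x * column_sign s a b x"
  have tt: "?t i ` ?t i ` x = x" for i x by (simp add: image_image)
  have "\<exists>h\<in>W. (\<forall>i<m. act (?t i) h = (\<lambda>x. - h x)) \<and> ?ip h \<noteq> 0" if "m \<le> s" for m
    using that
  proof (induction m)
    case 0
    then show ?case using f by auto
  next
    case (Suc m)
    then obtain h where h: "h \<in> W" "\<forall>i<m. act (?t i) h = (\<lambda>x. - h x)" "?ip h \<noteq> 0" by auto
    have m: "m < s" using Suc by simp
    have hi: "h (?t i ` x) = - h x" if "i < m" for i x
      using h(2) that by (metis act_def inv_transpose_eq)
    \<comment> \<open>Subtracting the image under the next transposition adds antisymmetry in that
      column. It is kept in the earlier ones because transpositions of different columns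
      commute.\<close>
    define k where "k = (\<lambda>x. h x - act (?t m) h x)"
    have "k \<in> W" unfolding k_def
      using h(1) transpose_permutes[OF col m] by (intro G_subspace_closed[OF W(1)])
    moreover have "act (?t i) k = (\<lambda>x. - k x)" if "i < Suc m" for i
    proof (cases "i = m")
      case True
      then show ?thesis by (simp add: k_def act_def tt)
    next
      case False
      then have i: "i < m" "i < s" using that m by auto
      have "?t i (?t m y) = ?t m (?t i y)" for y
        using columnsD[OF col] i m False by (auto simp: transpose_def)
      then have "?t m ` ?t i ` x = ?t i ` ?t m ` x" for x by (simp add: image_image)
      then show ?thesis using hi[OF i(1)] by (simp add: k_def act_def)
    qed
    \<comment> \<open>The sign is itself antisymmetric, so the subtraction doubles the pairing
      instead of destroying it.\<close>
    moreover have "?ip k = 2 * ?ip h"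
    proof -
      have "?ip (act (?t m) h) = (\<Sum>x\<in>Xr \<Omega> s. h x * column_sign s a b (?t m ` x))"
        by (rule sum.reindex_bij_witness[of _ "image (?t m)" "image (?t m)"])
           (auto simp: tt transpose_mem_Xr[OF col m] act_def)
      then have "?ip (act (?t m) h) = - ?ip h"
        by (simp add: column_sign_transpose[OF col m] sum_negf)
      then show ?thesis by (simp add: k_def left_diff_distrib sum_subtractf)
    qed
    ultimately show ?case using h(3) by (intro bexI[of _ k]) auto
  qed
  from this[of s] obtain h where h: "h \<in> W" "\<And>i. i < s \<Longrightarrow> act (?t i) h = (\<lambda>x. - h x)" "?ip h \<noteq> 0"
    by auto
  have "\<exists>c. h = (\<lambda>x. c * polytab \<Omega> s s a b x)"
  proof (rule antisymmetric_eq_scaled_polytab[OF fin col _ h(2)])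
    show "h \<in> L2Xr \<Omega> s" using h(1) W(2) by blast
    fix R R' assume R: "R \<subseteq> \<Omega> - (a ` {..<s} \<union> b ` {..<s})" "R' \<subseteq> \<Omega> - (a ` {..<s} \<union> b ` {..<s})"
      "card R = s - s" "card R' = s - s"
    then have "finite R" "finite R'" using fin by (auto intro: finite_subset)
    then show "h (a ` {..<s} \<union> R) = h (a ` {..<s} \<union> R')" using R by simp
  qed
  then obtain c where c: "h = (\<lambda>x. c * polytab \<Omega> s s a b x)" by blast
  have "c \<noteq> 0" using h(3) by (auto simp: c)
  then have "polytab \<Omega> s s a b = (\<lambda>x. inverse c * h x)" by (simp add: c fun_eq_iff)
  then show ?thesis using G_subspace_closed(2)[OF W(1) h(1), of "inverse c"] by simp
qed

text \<open>Permutations act transitively on families of columns, so a single polytabloid generates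
  the space.\<close>

lemma polytab_space_subset_G_subspace:
  assumes fin: "finite \<Omega>" and col: "columns \<Omega> s a b" and W: "G_subspace \<Omega> W" "polytab \<Omega> r s a b \<in> W"
  shows "polytab_space \<Omega> r s \<subseteq> W"
proof (rule polytab_space_least)
  show "csubspace W" using W by (simp add: G_subspace_def)
  fix a' b' assume col': "columns \<Omega> s a' b'"
  obtain g where g: "g permutes \<Omega>" "\<And>i. i < s \<Longrightarrow> g (a i) = a' i" "\<And>i. i < s \<Longrightarrow> g (b i) = b' i"
    using columns_transitive[OF fin col col'] by metis
  have "act g (polytab \<Omega> r s a b) = polytab \<Omega> r s a' b'"
    unfolding act_polytab[OF g(1)] using g by (intro polytab_cong) auto
  then show "polytab \<Omega> r s a' b' \<in> W" using G_subspace_closed(4)[OF W(1) g(1) W(2)] by simp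
qed

text \<open>The argument of James' submodule theorem: a nonzero \<open>f\<close> in \<open>W\<close>
  lies in the span of the polytabloids, so by positive definiteness it is not orthogonal to all of
  them. Antisymmetrising it then puts a polytabloid into \<open>W\<close>.\<close>

lemma G_irreducible_polytab_space_same:
  assumes fin: "finite \<Omega>" and s: "2 * s \<le> card \<Omega>"
  shows "G_irreducible \<Omega> (polytab_space \<Omega> s s)"
  unfolding G_irreducible_def
proof (intro conjI allI impI)
  let ?V = "polytab_space \<Omega> s s"
  show "G_subspace \<Omega> ?V" by (rule G_subspace_polytab_space)
  obtain a b where "columns \<Omega> s a b" by (rule exists_columns[OF fin s])
  then show "?V \<noteq> {\<lambda>_. 0}" using polytab_same_neq_0 polytab_in_polytab_space by blast
  fix W assume "G_subspace \<Omega> W \<and> W \<subseteq> ?V"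
  then have W: "G_subspace \<Omega> W" "W \<subseteq> ?V" by auto
  show "W = {\<lambda>_. 0} \<or> W = ?V"
  proof (cases "W = {\<lambda>_. 0}")
    case False
    then obtain f where f: "f \<in> W" "f \<noteq> (\<lambda>_. 0)" using G_subspace_closed(5)[OF W(1)] by auto
    have WL: "W \<subseteq> L2Xr \<Omega> s" using W(2) polytab_space_subset_L2Xr by blast
    have "\<exists>a b. columns \<Omega> s a b \<and> (\<Sum>x\<in>Xr \<Omega> s. f x * column_sign s a b x) \<noteq> 0"
    proof (rule ccontr)
      assume no: "\<not> ?thesis"
      have "?V \<subseteq> {h. (\<Sum>x\<in>Xr \<Omega> s. f x * cnj (h x)) = 0}"
      proof (rule polytab_space_least)
        show "csubspace {h. (\<Sum>x\<in>Xr \<Omega> s. f x * cnj (h x)) = 0}"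
          by (simp add: csubspace_def distrib_left sum.distrib mult.left_commute[of _ "cnj _"]
              flip: sum_distrib_left)
        fix a b assume "columns \<Omega> s a b"
        then have "(\<Sum>x\<in>Xr \<Omega> s. f x * column_sign s a b x) = 0" using no by blast
        then show "polytab \<Omega> s s a b \<in> {h. (\<Sum>x\<in>Xr \<Omega> s. f x * cnj (h x)) = 0}"
          by (simp add: polytab_def cnj_column_sign)
      qed
      then have "(\<Sum>x\<in>Xr \<Omega> s. f x * cnj (f x)) = 0" using f W by blast
      then have "complex_of_real (\<Sum>x\<in>Xr \<Omega> s. (cmod (f x))\<^sup>2) = 0"
        by (simp only: of_real_sum complex_norm_square)
      then have "(\<Sum>x\<in>Xr \<Omega> s. (cmod (f x))\<^sup>2) = 0" by (simp only: of_real_eq_0_iff)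
      then have "\<forall>x\<in>Xr \<Omega> s. f x = 0"
        by (subst (asm) sum_nonneg_eq_0_iff) (auto simp: finite_Xr fin)
      moreover have "f x = 0" if "x \<notin> Xr \<Omega> s" for x using f WL that by (auto simp: L2Xr_def)
      ultimately have "f x = 0" for x by blast
      then show False using f(2) by blast
    qed
    then obtain a b where col: "columns \<Omega> s a b" "(\<Sum>x\<in>Xr \<Omega> s. f x * column_sign s a b x) \<noteq> 0" by blast
    have "polytab \<Omega> s s a b \<in> W" by (rule polytab_in_G_subspace[OF fin col(1) W(1) WL f(1) col(2)])
    then have "?V \<subseteq> W" by (rule polytab_space_subset_G_subspace[OF fin col(1) W(1)])
    then show ?thesis using W by blast
  qed simp
qed

text \<open>For \<open>r > s\<close> antisymmetry alone does not determine a function up to scalars,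
  so \<open>W\<close> is pulled back along \<open>up_map\<close> to the irreducible space at level
  \<open>s\<close>. A zero pull-back forces \<open>W\<close> to be zero, since \<open>up_map\<close>
  after \<open>down_map\<close> is a nonzero scalar; a full one puts a polytabloid into
  \<open>W\<close>.\<close>

lemma G_irreducible_polytab_space:
  assumes fin: "finite \<Omega>" and s: "s \<le> r" "r + s \<le> card \<Omega>"
  shows "G_irreducible \<Omega> (polytab_space \<Omega> r s)"
  unfolding G_irreducible_def
proof (intro conjI allI impI)
  let ?V = "polytab_space \<Omega> r s"
  let ?c = "of_nat ((card \<Omega> - 2 * s) choose (r - s)) :: complex"
  have c: "?c \<noteq> 0" using s by (simp add: binomial_eq_0_iff)
  have s2: "2 * s \<le> card \<Omega>" using s by simp
  show "G_subspace \<Omega> ?V" by (rule G_subspace_polytab_space)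
  obtain a b where col: "columns \<Omega> s a b" by (rule exists_columns[OF fin s2])
  then show "?V \<noteq> {\<lambda>_. 0}" using polytab_neq_0[OF fin col s] polytab_in_polytab_space by blast
  fix W assume "G_subspace \<Omega> W \<and> W \<subseteq> ?V"
  then have W: "G_subspace \<Omega> W" "W \<subseteq> ?V" by auto
  define W' where "W' = {f \<in> polytab_space \<Omega> s s. up_map \<Omega> s r f \<in> W}"
  note cl = G_subspace_closed[OF W(1)] G_subspace_closed[OF G_subspace_polytab_space[of \<Omega> s s]]
  have "G_subspace \<Omega> W'"
    unfolding G_subspace_def csubspace_def G_invariant_def W'_def
    by (auto simp: up_map_linear up_map_act[OF fin] cl)
  then have "W' = {\<lambda>_. 0} \<or> W' = polytab_space \<Omega> s s"
    using G_irreducible_polytab_space_same[OF fin s2] unfolding G_irreducible_def W'_def by blast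
  then show "W = {\<lambda>_. 0} \<or> W = ?V"
  proof
    assume W': "W' = {\<lambda>_. 0}"
    have "w = (\<lambda>_. 0)" if w: "w \<in> W" for w
    proof -
      have wV: "w \<in> ?V" using w W by blast
      have ud: "up_map \<Omega> s r (down_map \<Omega> s r w) = (\<lambda>x. ?c * w x)" by (rule up_down_map[OF fin wV s(1)])
      then have "down_map \<Omega> s r w \<in> W'"
        using down_map_polytab_space[OF fin wV s(1)] cl(2)[OF w] by (simp add: W'_def)
      then have "down_map \<Omega> s r w = (\<lambda>_. 0)" using W' by blast
      then have "(\<lambda>x. ?c * w x) = (\<lambda>_. 0)" using ud by (simp add: up_map_linear)
      then show ?thesis using c by (simp add: fun_eq_iff)
    qed
    then show ?thesis using cl(5) by blast
  next
    assume "W' = polytab_space \<Omega> s s"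
    then have "polytab \<Omega> s s a b \<in> W'" using polytab_in_polytab_space[OF col] by simp
    then have "polytab \<Omega> r s a b \<in> W" by (simp add: W'_def up_map_polytab[OF fin col])
    then have "?V \<subseteq> W" by (rule polytab_space_subset_G_subspace[OF fin col W(1)])
    then show ?thesis using W by blast
  qed
qed

lemma G_isomorphic_polytab_space_specht:
  assumes fin: "finite \<Omega>" and s: "s \<le> r" "r + s \<le> card \<Omega>"
  shows "G_isomorphic \<Omega> (polytab_space \<Omega> r s) (specht \<Omega> s)"
  unfolding G_isomorphic_def specht_eq_polytab_space
proof (intro exI[of _ "down_map \<Omega> s r"] conjI ballI allI impI)
  let ?c = "of_nat ((card \<Omega> - 2 * s) choose (r - s)) :: complex"
  have c: "?c \<noteq> 0" using s by (simp add: binomial_eq_0_iff)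
  let ?u = "\<lambda>f x. inverse ?c * up_map \<Omega> s r f x"
  show "bij_betw (down_map \<Omega> s r) (polytab_space \<Omega> r s) (polytab_space \<Omega> s s)"
  proof (rule bij_betw_byWitness[of _ ?u])
    show "\<forall>f\<in>polytab_space \<Omega> r s. ?u (down_map \<Omega> s r f) = f"
      using c by (simp add: up_down_map[OF fin _ s(1)] fun_eq_iff)
    show "\<forall>f\<in>polytab_space \<Omega> s s. down_map \<Omega> s r (?u f) = f"
      using c by (simp add: down_map_linear down_up_map[OF fin _ s(1)]) (simp add: fun_eq_iff)
    show "down_map \<Omega> s r ` polytab_space \<Omega> r s \<subseteq> polytab_space \<Omega> s s"
      using down_map_polytab_space[OF fin _ s(1)] by blast
    show "?u ` polytab_space \<Omega> s s \<subseteq> polytab_space \<Omega> r s"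
      using up_map_polytab_space[OF fin] G_subspace_closed(2)[OF G_subspace_polytab_space] by blast
  qed
qed (simp_all add: down_map_linear down_map_act[OF fin _ _ s(1)])

text \<open>The preimage of a polytabloid under the isomorphism has the same antisymmetries and is
  fixed by the same stabiliser, so it is a multiple of \<open>polytab \<Omega> r s a b\<close>. Thus
  \<open>V\<close> contains a generator of the polytabloid space.\<close>

lemma G_isomorphic_specht_imp_eq:
  assumes fin: "finite \<Omega>" and s: "s \<le> r" "r + s \<le> card \<Omega>"
    and V: "V \<subseteq> L2Xr \<Omega> r" "G_irreducible \<Omega> V" "G_isomorphic \<Omega> V (specht \<Omega> s)"
  shows "V = polytab_space \<Omega> r s"
proof -
  have G: "G_subspace \<Omega> V" using V(2) by (simp add: G_irreducible_def)
  note cl = G_subspace_closed[OF G]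
  obtain T where T: "bij_betw T V (polytab_space \<Omega> s s)"
    and hom: "\<And>c f. f \<in> V \<Longrightarrow> T (\<lambda>x. c * f x) = (\<lambda>x. c * T f x)"
    and eqv: "\<And>g f. g permutes \<Omega> \<Longrightarrow> f \<in> V \<Longrightarrow> T (act g f) = act g (T f)"
    using V(3) unfolding G_isomorphic_def specht_eq_polytab_space by blast
  have inj: "f = h" if "T f = T h" "f \<in> V" "h \<in> V" for f h
    using T that by (auto simp: bij_betw_def inj_on_def)
  have "2 * s \<le> card \<Omega>" using s by simp
  then obtain a b where col: "columns \<Omega> s a b" by (rule exists_columns[OF fin])
  obtain h where h: "h \<in> V" "T h = polytab \<Omega> s s a b"
    using T polytab_in_polytab_space[OF col] by (metis bij_betw_imp_surj_on image_iff)
  have "\<exists>c. h = (\<lambda>x. c * polytab \<Omega> r s a b x)"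
  proof (rule equivariant_eq_scaled_polytab[OF fin col])
    show "h \<in> L2Xr \<Omega> r" using h V by blast
    fix i assume i: "i < s"
    note t = transpose_permutes[OF col i]
    have "T (act (transpose (a i) (b i)) h) = T (\<lambda>x. - 1 * h x)"
      using hom[OF h(1), of "- 1"] by (simp add: eqv[OF t h(1)] h(2) act_transpose_polytab[OF col i])
    then show "act (transpose (a i) (b i)) h = (\<lambda>x. - h x)"
      using inj cl(4)[OF t h(1)] cl(2)[OF h(1), of "- 1"] by simp
  next
    fix g assume g: "g permutes \<Omega>" "\<And>i. i < s \<Longrightarrow> g (a i) = a i \<and> g (b i) = b i"
    have "polytab \<Omega> s s (g \<circ> a) (g \<circ> b) = polytab \<Omega> s s a b"
      using g(2) by (intro polytab_cong) auto
    then have "T (act g h) = T h" by (simp add: eqv[OF g(1) h(1)] h(2) act_polytab[OF g(1)])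
    then show "act g h = h" using inj cl(4)[OF g(1) h(1)] h(1) by blast
  qed
  then obtain c where c: "h = (\<lambda>x. c * polytab \<Omega> r s a b x)" by blast
  have "c \<noteq> 0"
  proof
    assume "c = 0"
    then have "polytab \<Omega> s s a b = (\<lambda>x. 0)"
      using hom[OF h(1), of 0] h(2) by (simp add: c)
    then show False using polytab_same_neq_0[OF col] by simp
  qed
  then have "polytab \<Omega> r s a b = (\<lambda>x. inverse c * h x)" by (simp add: c fun_eq_iff)
  then have "polytab \<Omega> r s a b \<in> V" using cl(2)[OF h(1), of "inverse c"] by simp
  then have "polytab_space \<Omega> r s \<subseteq> V" by (rule polytab_space_subset_G_subspace[OF fin col G])
  moreover have "polytab_space \<Omega> r s \<noteq> {\<lambda>_. 0}" "G_subspace \<Omega> (polytab_space \<Omega> r s)"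
    using G_irreducible_polytab_space[OF fin s] by (auto simp: G_irreducible_def)
  ultimately show ?thesis using V(2) unfolding G_irreducible_def by blast
qed

lemma L2Xrs_eq_polytab_space:
  assumes "finite \<Omega>" "s \<le> r" "r + s \<le> card \<Omega>"
  shows "L2Xrs \<Omega> r s = polytab_space \<Omega> r s"
  unfolding L2Xrs_def
proof (rule the_equality)
  show "polytab_space \<Omega> r s \<subseteq> L2Xr \<Omega> r \<and> G_irreducible \<Omega> (polytab_space \<Omega> r s)
    \<and> G_isomorphic \<Omega> (polytab_space \<Omega> r s) (specht \<Omega> s)"
    using polytab_space_subset_L2Xr G_irreducible_polytab_space[OF assms]
      G_isomorphic_polytab_space_specht[OF assms] by blast
qed (use G_isomorphic_specht_imp_eq[OF assms] in blast)

section \<open>Composition of the kernels\<close>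

lemma column_kernel_commute: "column_kernel \<Omega> s x y = column_kernel \<Omega> s y x"
  by (simp add: column_kernel_def mult.commute)

lemma card_Diff_permutes: "g permutes \<Omega> \<Longrightarrow> card (g ` x - g ` y) = card (x - y)"
  by (metis card_image image_set_diff inj_on_subset permutes_inj top_greatest)

text \<open>Only the transversals \<open>F J\<close>, with the bottom entry taken exactly in the
  columns \<open>J\<close>, have nonzero sign. That sign cancels the one in the kernel, and the
  remaining binomial coefficients add up by the hockey-stick identity.\<close>

lemma sum_column_kernel_polytab_top:
  assumes fin: "finite \<Omega>" and col: "columns \<Omega> s a b"
  shows "(\<Sum>y\<in>Xr \<Omega> s. column_kernel \<Omega> s (a ` {..<s}) y * column_sign s a b y)
    = 2 ^ s * fact s ^ 2 * of_nat ((card \<Omega> - s + 1) choose s)"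
proof -
  let ?I = "{..<s}" and ?n = "card \<Omega>"
  define F where "F = (\<lambda>J. a ` (?I - J) \<union> b ` J)"
  have n: "2 * s \<le> ?n"
    using card_columns[OF col] card_mono[OF fin, of "a ` ?I \<union> b ` ?I"] col by (simp add: columns_def)
  have aX: "a ` ?I \<in> Xr \<Omega> s" using col by (auto simp: Xr_def columns_def card_image)
  have aF: "a i \<in> F J \<longleftrightarrow> i \<notin> J" and bF: "b i \<in> F J \<longleftrightarrow> i \<in> J" if "i < s" "J \<subseteq> ?I" for i J
    using that columnsD[OF col] by (auto simp: F_def image_iff)
  have injF: "inj_on F (Pow ?I)"
  proof (rule inj_onI)
    fix J K assume J: "J \<in> Pow ?I" "K \<in> Pow ?I" and eq: "F J = F K"
    have "i \<in> J \<longleftrightarrow> i \<in> K" for i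
    proof (cases "i < s")
      case True
      then show ?thesis using bF[OF True, of J] bF[OF True, of K] J eq by simp
    qed (use J in auto)
    then show "J = K" by blast
  qed
  have FX: "F J \<in> Xr \<Omega> s" if "J \<subseteq> ?I" for J
  proof -
    have fJ: "finite J" using that finite_subset by blast
    have "card (F J) = card (a ` (?I - J)) + card (b ` J)"
      unfolding F_def using fJ that columnsD(5)[OF col] by (intro card_Un_disjoint) auto
    also have "card (a ` (?I - J)) = card (?I - J)"
      using col by (intro card_image) (auto simp: columns_def intro: inj_on_subset)
    also have "card (b ` J) = card J"
      using col that by (intro card_image) (auto simp: columns_def intro: inj_on_subset)
    also have "card (?I - J) + card J = s"
      using that fJ card_mono[of ?I J] by (simp add: card_Diff_subset)
    finally show ?thesis using that columnsD[OF col] by (auto simp: Xr_def F_def)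
  qed
  have signF: "column_sign s a b (F J) = (-1) ^ card J" if "J \<subseteq> ?I" for J
  proof -
    have "column_sign s a b (F J) = (\<Prod>i<s. if i \<in> J then - 1 else 1)"
      unfolding column_sign_def by (intro prod.cong) (auto simp: aF[OF _ that] bF[OF _ that])
    also have "\<dots> = (\<Prod>i\<in>J. - 1)" using that by (simp add: prod.inter_restrict[symmetric] Int_absorb1)
    finally show ?thesis by simp
  qed
  have kernF: "column_kernel \<Omega> s (a ` ?I) (F J)
      = 2 ^ s * ((-1) ^ card J * of_nat (fact s * fact (card J) * ffact (?n - s - card J) (s - card J)))"
    if J: "J \<subseteq> ?I" for J
  proof -
    have "a ` ?I - F J = a ` J" using J aF[OF _ J] by auto
    moreover have "card (a ` J) = card J"
      using col J by (intro card_image) (auto simp: columns_def intro: inj_on_subset)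
    ultimately have c: "card (a ` ?I - F J) = card J" by simp
    define k where "k = card J"
    have k: "k \<le> s" using card_mono[of ?I J] J by (simp add: k_def)
    \<comment> \<open>\<open>ffact (s - k) (s - j)\<close> vanishes for \<open>j < k\<close> and
      \<open>ffact k j\<close> for \<open>j > k\<close>, so only \<open>j = k\<close>
      survives.\<close>
    have "poly (hahn_poly ?n s s s) (of_nat k) = (\<Sum>j\<in>{k}. of_nat (s choose j) * ((-1) ^ j *
      of_nat (ffact (s - k) (s - j) * ffact (s - (s - j)) j * (ffact k j * ffact (?n - s - j) (s - j)))))"
      by (subst poly_hahn_poly[OF k], rule sum.mono_neutral_right)
         (use k in \<open>auto simp: ffact_eq_0_iff\<close>)
    also have "\<dots> = (-1) ^ k * of_nat ((fact k * fact (s - k) * (s choose k)) * fact k * ffact (?n - s - k) (s - k))"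
      using k by (simp add: ffact_self)
    also have "fact k * fact (s - k) * (s choose k) = fact s" by (rule binomial_fact_lemma[OF k])
    finally show ?thesis using column_kernel_eq_poly[OF fin aX FX[OF J]] c by (simp add: k_def)
  qed
  have "(\<Sum>y\<in>Xr \<Omega> s. column_kernel \<Omega> s (a ` ?I) y * column_sign s a b y)
    = (\<Sum>y\<in>F ` Pow ?I. column_kernel \<Omega> s (a ` ?I) y * column_sign s a b y)"
  proof (rule sum.mono_neutral_right)
    show "finite (Xr \<Omega> s)" by (rule finite_Xr[OF fin])
    show "F ` Pow ?I \<subseteq> Xr \<Omega> s" using FX by auto
    show "\<forall>y\<in>Xr \<Omega> s - F ` Pow ?I. column_kernel \<Omega> s (a ` ?I) y * column_sign s a b y = 0"
    proof (rule ballI, rule ccontr)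
      fix y assume y: "y \<in> Xr \<Omega> s - F ` Pow ?I"
        and "column_kernel \<Omega> s (a ` ?I) y * column_sign s a b y \<noteq> 0"
      then have ab: "(a i \<in> y) \<noteq> (b i \<in> y)" if "i < s" for i
        using that column_sign_eq_0_iff[of s a b y] by auto
      define J where "J = {i. i < s \<and> b i \<in> y}"
      have J: "J \<subseteq> ?I" by (auto simp: J_def)
      have "F J \<subseteq> y" using ab by (auto simp: F_def J_def)
      moreover have "finite y" "card y = s" "card (F J) = s"
        using y FX[OF J] fin by (auto simp: Xr_def intro: finite_subset)
      ultimately have "F J = y" by (metis card_subset_eq)
      then show False using y J by blast
    qed
  qed
  also have "\<dots> = (\<Sum>J\<in>Pow ?I. column_kernel \<Omega> s (a ` ?I) (F J) * column_sign s a b (F J))"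
    using injF by (simp add: sum.reindex)
  also have "\<dots> = (\<Sum>J\<in>Pow ?I. (\<lambda>j. 2 ^ s * of_nat (fact s * fact j * ffact (?n - s - j) (s - j))) (card J))"
    by (intro sum.cong refl) (simp add: kernF signF)
  also have "\<dots> = (\<Sum>j\<le>s. of_nat (s choose j) * (2 ^ s * of_nat (fact s * fact j * ffact (?n - s - j) (s - j))))"
    by (subst sum_Pow_card) simp_all
  also have "\<dots> = (\<Sum>j\<le>s. 2 ^ s * fact s ^ 2 * of_nat ((?n - s - j) choose (s - j)))"
  proof (intro sum.cong refl)
    fix j assume "j \<in> {..s}"
    then have j: "fact j * fact (s - j) * (s choose j) = (fact s :: nat)" by (simp add: binomial_fact_lemma)
    have "(s choose j) * (fact s * fact j * ffact (?n - s - j) (s - j))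
      = fact s * (fact j * fact (s - j) * (s choose j)) * ((?n - s - j) choose (s - j))"
      by (simp add: ffact_binomial mult_ac)
    also have "\<dots> = fact s ^ 2 * ((?n - s - j) choose (s - j))" by (simp only: j power2_eq_square)
    finally have "of_nat ((s choose j) * (fact s * fact j * ffact (?n - s - j) (s - j)))
      = (of_nat (fact s ^ 2 * ((?n - s - j) choose (s - j))) :: complex)" by (rule arg_cong)
    then show "of_nat (s choose j) * (2 ^ s * of_nat (fact s * fact j * ffact (?n - s - j) (s - j)))
      = 2 ^ s * fact s ^ 2 * (of_nat ((?n - s - j) choose (s - j)) :: complex)"
      by (simp add: mult_ac)
  qed
  also have "\<dots> = 2 ^ s * fact s ^ 2 * of_nat (\<Sum>j\<le>s. (?n - s - j) choose (s - j))"
    by (simp add: sum_distrib_left)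
  \<comment> \<open>With \<open>i = s - j\<close> the upper entry \<open>n - s - j\<close> becomes
    \<open>(n - 2 * s) + i\<close>.\<close>
  also have "(\<Sum>j\<le>s. (?n - s - j) choose (s - j)) = (\<Sum>i\<le>s. ((?n - 2 * s) + i) choose i)"
    using n by (intro sum.reindex_bij_witness[of _ "\<lambda>i. s - i" "\<lambda>i. s - i"]) auto
  also have "\<dots> = Suc (?n - 2 * s + s) choose s" by (rule sum_choose_lower)
  also have "Suc (?n - 2 * s + s) = ?n - s + 1" using n by simp
  finally show ?thesis .
qed

text \<open>The eigenvalue of the column kernel on \<open>r\<close>-subsets: the cost of passing to
  \<open>s\<close>-subsets times the eigenvalue for \<open>r = s\<close>.\<close>

definition kernel_scale :: "nat \<Rightarrow> nat \<Rightarrow> nat \<Rightarrow> complex" where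
  "kernel_scale n s r = of_nat ((n - 2 * s) choose (r - s)) * (2 ^ s * fact s ^ 2 * of_nat ((n - s + 1) choose s))"

lemma kernel_scale_neq_0: "s \<le> r \<Longrightarrow> r + s \<le> n \<Longrightarrow> kernel_scale n s r \<noteq> 0"
  by (auto simp: kernel_scale_def binomial_eq_0_iff)

text \<open>The kernel depends only on the size of the difference, so it is invariant under column
  transpositions. The sum is then antisymmetric in \<open>x\<close>, hence a multiple of the sign,
  and the set of top entries, where the sign is 1, gives the factor.\<close>

lemma sum_column_kernel_column_sign_same:
  assumes fin: "finite \<Omega>" and col: "columns \<Omega> s a b" and x: "x \<in> Xr \<Omega> s"
  shows "(\<Sum>y\<in>Xr \<Omega> s. column_kernel \<Omega> s x y * column_sign s a b y)
    = 2 ^ s * fact s ^ 2 * of_nat ((card \<Omega> - s + 1) choose s) * column_sign s a b x"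
proof -
  define h where "h = (\<lambda>x. if x \<in> Xr \<Omega> s then \<Sum>y\<in>Xr \<Omega> s. column_kernel \<Omega> s x y * column_sign s a b y else 0)"
  have "\<exists>c. h = (\<lambda>x. c * polytab \<Omega> s s a b x)"
  proof (rule antisymmetric_eq_scaled_polytab[OF fin col])
    show "h \<in> L2Xr \<Omega> s" by (simp add: L2Xr_def h_def)
    fix R R' assume R: "R \<subseteq> \<Omega> - (a ` {..<s} \<union> b ` {..<s})" "R' \<subseteq> \<Omega> - (a ` {..<s} \<union> b ` {..<s})"
      "card R = s - s" "card R' = s - s"
    then have "finite R" "finite R'" using fin by (auto intro: finite_subset)
    then show "h (a ` {..<s} \<union> R) = h (a ` {..<s} \<union> R')" using R by simp
  next
    fix i assume i: "i < s"
    let ?t = "transpose (a i) (b i)"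
    have tt: "?t ` ?t ` x = x" for x by (simp add: image_image)
    have "h (?t ` x) = - h x" for x
    proof (cases "x \<in> Xr \<Omega> s")
      case True
      have tx: "?t ` x \<in> Xr \<Omega> s" using True by (simp add: transpose_mem_Xr[OF col i])
      have "(\<Sum>y\<in>Xr \<Omega> s. column_kernel \<Omega> s (?t ` x) y * column_sign s a b y)
        = (\<Sum>y\<in>Xr \<Omega> s. column_kernel \<Omega> s (?t ` x) (?t ` y) * column_sign s a b (?t ` y))"
        by (rule sum.reindex_bij_witness[of _ "image ?t" "image ?t"]) (auto simp: tt transpose_mem_Xr[OF col i])
      also have "\<dots> = (\<Sum>y\<in>Xr \<Omega> s. - (column_kernel \<Omega> s x y * column_sign s a b y))"
      proof (intro sum.cong refl)
        fix y assume y: "y \<in> Xr \<Omega> s"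
        then have "?t ` y \<in> Xr \<Omega> s" by (simp add: transpose_mem_Xr[OF col i])
        then have "column_kernel \<Omega> s (?t ` x) (?t ` y) = column_kernel \<Omega> s x y"
          by (simp add: column_kernel_eq_poly[OF fin tx] column_kernel_eq_poly[OF fin True y]
              card_Diff_permutes[OF transpose_permutes[OF col i]])
        then show "column_kernel \<Omega> s (?t ` x) (?t ` y) * column_sign s a b (?t ` y)
          = - (column_kernel \<Omega> s x y * column_sign s a b y)"
          by (simp add: column_sign_transpose[OF col i])
      qed
      finally show ?thesis using True tx by (simp add: h_def sum_negf)
    qed (simp add: h_def transpose_mem_Xr[OF col i])
    then show "act ?t h = (\<lambda>x. - h x)" by (simp add: act_def)
  qed
  then obtain c where c: "h = (\<lambda>x. c * polytab \<Omega> s s a b x)" by blast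
  have top: "a ` {..<s} \<in> Xr \<Omega> s" using col by (auto simp: Xr_def columns_def card_image)
  moreover have "column_sign s a b (a ` {..<s}) = 1"
    using columnsD[OF col] unfolding column_sign_def by (intro prod.neutral) auto
  ultimately have "c = h (a ` {..<s})" by (simp add: c polytab_def)
  also have "\<dots> = 2 ^ s * fact s ^ 2 * of_nat ((card \<Omega> - s + 1) choose s)"
    using top sum_column_kernel_polytab_top[OF fin col] by (simp add: h_def)
  finally show ?thesis using fun_cong[OF c, of x] x by (simp add: h_def polytab_def)
qed

text \<open>Each sign at \<open>x\<close> in the kernel is a sum over \<open>s\<close>-subsets
  \<open>z\<close> of \<open>x\<close>, and each pairing over \<open>r\<close>-subsets reduces to
  one over \<open>s\<close>-subsets. This leaves the case \<open>r = s\<close> at every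
  \<open>z\<close>, and the sum over \<open>z\<close> collapses to the sign at \<open>x\<close>. The
  size of \<open>x\<close> is free, as needed for operators between different levels.\<close>

lemma sum_column_kernel_column_sign:
  assumes fin: "finite \<Omega>" and col: "columns \<Omega> s a b" and x: "x \<subseteq> \<Omega>" and r: "s \<le> r"
  shows "(\<Sum>y\<in>Xr \<Omega> r. column_kernel \<Omega> s x y * column_sign s a b y)
    = kernel_scale (card \<Omega>) s r * column_sign s a b x"
proof -
  let ?P = "column_pairs \<Omega> s" and ?c = "of_nat ((card \<Omega> - 2 * s) choose (r - s)) :: complex"
  let ?Z = "{z. z \<in> Xr \<Omega> s \<and> z \<subseteq> x}"
  let ?e = "\<lambda>p. column_sign s (fst p) (snd p)"
  have P: "columns \<Omega> s (fst p) (snd p)" if "p \<in> ?P" for p using that by (cases p) (simp add: column_pairs_def)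
  have K: "column_kernel \<Omega> s x y = (\<Sum>p\<in>?P. ?e p x * ?e p y)" for x y
    by (simp add: column_kernel_def split_def)
  have "(\<Sum>y\<in>Xr \<Omega> r. column_kernel \<Omega> s x y * column_sign s a b y)
    = (\<Sum>p\<in>?P. ?e p x * (\<Sum>y\<in>Xr \<Omega> r. ?e p y * column_sign s a b y))"
    unfolding K sum_distrib_right sum_distrib_left by (subst sum.swap) (simp add: mult_ac)
  also have "\<dots> = (\<Sum>p\<in>?P. (\<Sum>z\<in>?Z. ?e p z) * (?c * (\<Sum>y\<in>Xr \<Omega> s. ?e p y * column_sign s a b y)))"
    by (intro sum.cong refl arg_cong2[where f = "(*)"])
       (simp_all add: P sum_column_sign_mult[OF fin _ col r] column_sign_eq_sum_subsets[OF fin _ x, symmetric])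
  also have "\<dots> = (\<Sum>p\<in>?P. \<Sum>z\<in>?Z. ?c * (\<Sum>y\<in>Xr \<Omega> s. ?e p z * ?e p y * column_sign s a b y))"
    by (intro sum.cong refl, subst sum_distrib_right, intro sum.cong refl) (simp add: sum_distrib_left mult_ac)
  also have "\<dots> = (\<Sum>z\<in>?Z. ?c * (\<Sum>p\<in>?P. \<Sum>y\<in>Xr \<Omega> s. ?e p z * ?e p y * column_sign s a b y))"
    by (subst sum.swap) (simp add: sum_distrib_left)
  also have "\<dots> = (\<Sum>z\<in>?Z. ?c * (\<Sum>y\<in>Xr \<Omega> s. column_kernel \<Omega> s z y * column_sign s a b y))"
    unfolding K sum_distrib_right by (subst (2) sum.swap) simp
  also have "\<dots> = (\<Sum>z\<in>?Z. kernel_scale (card \<Omega>) s r * column_sign s a b z)"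
    by (intro sum.cong refl) (simp add: sum_column_kernel_column_sign_same[OF fin col] kernel_scale_def)
  also have "\<dots> = kernel_scale (card \<Omega>) s r * column_sign s a b x"
    by (simp add: sum_distrib_left[symmetric] column_sign_eq_sum_subsets[OF fin col x, symmetric])
  finally show ?thesis .
qed

text \<open>As a function of \<open>y\<close> the second factor is a combination of signs, and the
  first multiplies all of them by the same scalar.\<close>

lemma column_kernel_compose:
  assumes fin: "finite \<Omega>" and x: "x \<subseteq> \<Omega>" and r: "s \<le> r"
  shows "(\<Sum>y\<in>Xr \<Omega> r. column_kernel \<Omega> s x y * column_kernel \<Omega> s y z)
    = kernel_scale (card \<Omega>) s r * column_kernel \<Omega> s x z"
proof -
  let ?P = "column_pairs \<Omega> s"
  let ?e = "\<lambda>p. column_sign s (fst p) (snd p)"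
  have P: "columns \<Omega> s (fst p) (snd p)" if "p \<in> ?P" for p using that by (cases p) (simp add: column_pairs_def)
  have K: "column_kernel \<Omega> s y z = (\<Sum>p\<in>?P. ?e p y * ?e p z)" for y z
    by (simp add: column_kernel_def split_def)
  have "(\<Sum>y\<in>Xr \<Omega> r. column_kernel \<Omega> s x y * column_kernel \<Omega> s y z)
    = (\<Sum>y\<in>Xr \<Omega> r. \<Sum>p\<in>?P. column_kernel \<Omega> s x y * ?e p y * ?e p z)"
    by (simp add: K[of _ z] sum_distrib_left mult.assoc)
  also have "\<dots> = (\<Sum>p\<in>?P. (\<Sum>y\<in>Xr \<Omega> r. column_kernel \<Omega> s x y * ?e p y) * ?e p z)"
    by (subst sum.swap) (simp add: sum_distrib_right)
  also have "\<dots> = (\<Sum>p\<in>?P. kernel_scale (card \<Omega>) s r * (?e p x * ?e p z))"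
    by (intro sum.cong refl) (simp add: sum_column_kernel_column_sign[OF fin P x r])
  finally show ?thesis by (simp add: K sum_distrib_left)
qed

section \<open>Identification and composition of the operators\<close>

lemma kernel_op_linear:
  "kernel_op \<Omega> r1 r2 p (\<lambda>x. 0) = (\<lambda>x. 0)"
  "kernel_op \<Omega> r1 r2 p (\<lambda>x. f x + h x) = (\<lambda>x. kernel_op \<Omega> r1 r2 p f x + kernel_op \<Omega> r1 r2 p h x)"
  "kernel_op \<Omega> r1 r2 p (\<lambda>x. c * f x) = (\<lambda>x. c * kernel_op \<Omega> r1 r2 p f x)"
  by (simp_all add: kernel_op_def fun_eq_iff sum.distrib sum_distrib_left algebra_simps)

lemma kernel_op_smult_diff:
  "kernel_op \<Omega> r1 r2 (smult c p - smult d q) f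
    = (\<lambda>x. c * kernel_op \<Omega> r1 r2 p f x - d * kernel_op \<Omega> r1 r2 q f x)"
  by (simp add: kernel_op_def fun_eq_iff sum_subtractf sum_distrib_left algebra_simps)

lemma kernel_op_act:
  assumes g: "g permutes \<Omega>"
  shows "kernel_op \<Omega> r1 r2 p (act g f) = act g (kernel_op \<Omega> r1 r2 p f)"
proof
  fix x
  note ig = permutes_inv[OF g]
  have gig: "g ` inv g ` y = y" "inv g ` g ` y = y" for y
    using permutes_inj[OF g] permutes_surj[OF g] by (simp_all add: image_f_inv_f image_inv_f_f)
  have "(\<Sum>y\<in>Xr \<Omega> r1. poly p (of_nat (card (x - y))) * f (inv g ` y))
    = (\<Sum>y\<in>Xr \<Omega> r1. poly p (of_nat (card (inv g ` x - y))) * f y)"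
  proof (rule sum.reindex_bij_witness[of _ "image g" "image (inv g)"])
    fix y assume "y \<in> Xr \<Omega> r1"
    show "poly p (of_nat (card (inv g ` x - inv g ` y))) * f (inv g ` y) = poly p (of_nat (card (x - y))) * f (inv g ` y)"
      by (simp add: card_Diff_permutes[OF ig])
  qed (auto simp: gig permutes_image_Xr[OF g] permutes_image_Xr[OF ig])
  then show "kernel_op \<Omega> r1 r2 p (act g f) x = act g (kernel_op \<Omega> r1 r2 p f) x"
    by (simp add: kernel_op_def act_def permutes_image_Xr[OF ig])
qed

text \<open>The divisor is the value of \<open>hahn_poly\<close> at 0.\<close>

definition Lambda_poly :: "nat \<Rightarrow> nat \<Rightarrow> nat \<Rightarrow> nat \<Rightarrow> complex poly" where
  "Lambda_poly n s r1 r2 = smult (inverse (of_nat (ffact r2 s * ffact (n - r1) s))) (hahn_poly n s r1 r2)"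

lemma degree_Lambda_poly:
  assumes "s \<le> r1" "r1 + s \<le> n" "s \<le> r2"
  shows "degree (Lambda_poly n s r1 r2) = s"
  using assms by (simp add: Lambda_poly_def degree_hahn_poly ffact_eq_0_iff)

lemma poly_Lambda_poly_0:
  assumes "r1 + s \<le> n" "s \<le> r2"
  shows "poly (Lambda_poly n s r1 r2) 0 = 1"
proof -
  have "of_nat (ffact r2 s * ffact (n - r1) s) \<noteq> (0 :: complex)" using assms by (simp add: ffact_eq_0_iff)
  then show ?thesis by (simp add: Lambda_poly_def poly_hahn_poly_0 del: of_nat_mult)
qed

lemma kernel_op_Lambda_poly:
  assumes fin: "finite \<Omega>" and x: "x \<in> Xr \<Omega> r2"
  shows "kernel_op \<Omega> r1 r2 (Lambda_poly (card \<Omega>) s r1 r2) f x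
    = inverse (2 ^ s * of_nat (ffact r2 s * ffact (card \<Omega> - r1) s)) * (\<Sum>y\<in>Xr \<Omega> r1. column_kernel \<Omega> s x y * f y)"
  using x unfolding kernel_op_def sum_distrib_left
  by (auto intro!: sum.cong simp: column_kernel_eq_poly[OF fin x] Lambda_poly_def)

lemma kernel_op_Lambda_poly_polytab:
  assumes fin: "finite \<Omega>" and col: "columns \<Omega> s a b" and r1: "s \<le> r1"
  shows "kernel_op \<Omega> r1 r2 (Lambda_poly (card \<Omega>) s r1 r2) (polytab \<Omega> r1 s a b)
    = (\<lambda>x. inverse (2 ^ s * of_nat (ffact r2 s * ffact (card \<Omega> - r1) s)) * kernel_scale (card \<Omega>) s r1
         * polytab \<Omega> r2 s a b x)"
proof
  fix x
  show "kernel_op \<Omega> r1 r2 (Lambda_poly (card \<Omega>) s r1 r2) (polytab \<Omega> r1 s a b) x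
    = inverse (2 ^ s * of_nat (ffact r2 s * ffact (card \<Omega> - r1) s)) * kernel_scale (card \<Omega>) s r1
        * polytab \<Omega> r2 s a b x"
  proof (cases "x \<in> Xr \<Omega> r2")
    case True
    then have "x \<subseteq> \<Omega>" by (simp add: Xr_def)
    have "(\<Sum>y\<in>Xr \<Omega> r1. column_kernel \<Omega> s x y * polytab \<Omega> r1 s a b y)
      = (\<Sum>y\<in>Xr \<Omega> r1. column_kernel \<Omega> s x y * column_sign s a b y)"
      by (intro sum.cong) (auto simp: polytab_def)
    also have "\<dots> = kernel_scale (card \<Omega>) s r1 * polytab \<Omega> r2 s a b x"
      using True by (simp add: sum_column_kernel_column_sign[OF fin col \<open>x \<subseteq> \<Omega>\<close> r1] polytab_def)
    finally show ?thesis by (simp add: kernel_op_Lambda_poly[OF fin True])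
  qed (simp add: kernel_op_def polytab_def)
qed

lemma sum_Pow_polytab:
  assumes "finite \<Omega>"
  shows "(\<Sum>x\<in>Pow \<Omega>. f x * cnj (polytab \<Omega> r s a b x)) = (\<Sum>x\<in>Xr \<Omega> r. f x * column_sign s a b x)"
  using assms by (intro sum.mono_neutral_cong_right) (auto simp: Xr_def polytab_def cnj_column_sign)

lemma is_Lambda_Lambda_poly:
  assumes fin: "finite \<Omega>" and r: "s \<le> r1" "r1 + s \<le> card \<Omega>" "s \<le> r2" "r2 + s \<le> card \<Omega>"
  shows "is_Lambda \<Omega> s r1 r2 (kernel_op \<Omega> r1 r2 (Lambda_poly (card \<Omega>) s r1 r2))"
proof -
  let ?p = "Lambda_poly (card \<Omega>) s r1 r2"
  note V = L2Xrs_eq_polytab_space[OF fin r(1,2)] L2Xrs_eq_polytab_space[OF fin r(3,4)]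
  have sub: "csubspace (polytab_space \<Omega> r2 s)" by (rule csubspace_polytab_space)
  have "polytab_space \<Omega> r1 s \<subseteq> {f. kernel_op \<Omega> r1 r2 ?p f \<in> polytab_space \<Omega> r2 s}"
  proof (rule polytab_space_least)
    show "csubspace {f. kernel_op \<Omega> r1 r2 ?p f \<in> polytab_space \<Omega> r2 s}"
      using sub by (simp add: csubspace_def kernel_op_linear)
    fix a b assume col: "columns \<Omega> s a b"
    show "polytab \<Omega> r1 s a b \<in> {f. kernel_op \<Omega> r1 r2 ?p f \<in> polytab_space \<Omega> r2 s}"
      unfolding mem_Collect_eq kernel_op_Lambda_poly_polytab[OF fin col r(1)]
      by (rule G_subspace_closed(2)[OF G_subspace_polytab_space polytab_in_polytab_space[OF col]])
  qed
  \<comment> \<open>The kernel is a sum of products, so the operator sees \<open>f\<close> only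
    through its pairings with polytabloids.\<close>
  moreover have "kernel_op \<Omega> r1 r2 ?p f = (\<lambda>_. 0)" if f: "f \<in> orth_compl \<Omega> (polytab_space \<Omega> r1 s)" for f
  proof
    fix x
    have "(\<Sum>y\<in>Xr \<Omega> r1. f y * column_sign s a b y) = 0" if "columns \<Omega> s a b" for a b
      using f polytab_in_polytab_space[OF that, of r1] sum_Pow_polytab[OF fin, of f r1 s a b]
      by (simp add: orth_compl_def)
    then have "(\<Sum>(a, b)\<in>column_pairs \<Omega> s. column_sign s a b x * (\<Sum>y\<in>Xr \<Omega> r1. f y * column_sign s a b y)) = 0"
      by (intro sum.neutral) (simp add: column_pairs_def split_def)
    moreover have "(\<Sum>y\<in>Xr \<Omega> r1. column_kernel \<Omega> s x y * f y)
      = (\<Sum>(a, b)\<in>column_pairs \<Omega> s. column_sign s a b x * (\<Sum>y\<in>Xr \<Omega> r1. f y * column_sign s a b y))"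
      unfolding column_kernel_def split_def sum_distrib_left sum_distrib_right
      by (subst sum.swap) (simp add: mult_ac)
    ultimately show "kernel_op \<Omega> r1 r2 ?p f x = 0"
      by (cases "x \<in> Xr \<Omega> r2") (simp_all add: kernel_op_Lambda_poly[OF fin], simp add: kernel_op_def)
  qed
  ultimately show ?thesis
    unfolding is_Lambda_def V using degree_Lambda_poly[OF r(1-3)] poly_Lambda_poly_0[OF r(2,3)] kernel_op_act
    by blast
qed

text \<open>The orthogonal projection onto the span of the polytabloids is a multiple of the integral
  operator with kernel \<open>column_kernel\<close>.\<close>

lemma L2X_decompose:
  assumes fin: "finite \<Omega>" and r: "s \<le> r" "r + s \<le> card \<Omega>" and f: "f \<in> L2X \<Omega>"
  obtains u v where "u \<in> polytab_space \<Omega> r s" "v \<in> orth_compl \<Omega> (polytab_space \<Omega> r s)"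
    "f = (\<lambda>x. u x + v x)"
proof -
  let ?V = "polytab_space \<Omega> r s" and ?P = "column_pairs \<Omega> s"
  let ?k = "kernel_scale (card \<Omega>) s r"
  \<comment> \<open>Dividing by \<open>?k\<close> makes the kernel operator the identity on
    polytabloids at level \<open>r\<close>. Values of \<open>f\<close> outside
    \<open>Xr \<Omega> r\<close> are left to \<open>v\<close>.\<close>
  define u where "u = (\<lambda>x. if x \<in> Xr \<Omega> r then inverse ?k * (\<Sum>y\<in>Xr \<Omega> r. column_kernel \<Omega> s x y * f y) else 0)"
  define v where "v = (\<lambda>x. f x - u x)"
  have "u = (\<lambda>x. \<Sum>p\<in>?P. (inverse ?k * (\<Sum>y\<in>Xr \<Omega> r. column_sign s (fst p) (snd p) y * f y))
      * polytab \<Omega> r s (fst p) (snd p) x)"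
  proof
    fix x
    have "(\<Sum>y\<in>Xr \<Omega> r. column_kernel \<Omega> s x y * f y)
      = (\<Sum>p\<in>?P. (\<Sum>y\<in>Xr \<Omega> r. column_sign s (fst p) (snd p) y * f y) * column_sign s (fst p) (snd p) x)"
      unfolding column_kernel_def split_def sum_distrib_right by (subst sum.swap) (simp add: mult_ac)
    then show "u x = (\<Sum>p\<in>?P. (inverse ?k * (\<Sum>y\<in>Xr \<Omega> r. column_sign s (fst p) (snd p) y * f y))
      * polytab \<Omega> r s (fst p) (snd p) x)"
      by (simp add: u_def polytab_def sum_distrib_left[where A = "column_pairs \<Omega> s"] mult.assoc)
  qed
  also have "\<dots> \<in> ?V"
    by (rule csubspace_sum[OF csubspace_polytab_space finite_column_pairs[OF fin]])
       (simp add: column_pairs_def split_def polytab_in_polytab_space)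
  finally have "u \<in> ?V" .
  moreover have "v \<in> orth_compl \<Omega> ?V"
  proof -
    have "?V \<subseteq> {h. (\<Sum>x\<in>Pow \<Omega>. v x * cnj (h x)) = 0}"
    proof (rule polytab_space_least)
      show "csubspace {h. (\<Sum>x\<in>Pow \<Omega>. v x * cnj (h x)) = 0}"
        by (simp add: csubspace_def distrib_left sum.distrib mult.left_commute[of _ "cnj _"] flip: sum_distrib_left)
      fix a b assume col: "columns \<Omega> s a b"
      have "(\<Sum>x\<in>Xr \<Omega> r. u x * column_sign s a b x)
        = inverse ?k * (\<Sum>x\<in>Xr \<Omega> r. \<Sum>y\<in>Xr \<Omega> r. column_kernel \<Omega> s x y * f y * column_sign s a b x)"
        by (simp add: u_def sum_distrib_left sum_distrib_right mult.assoc)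
      also have "(\<Sum>x\<in>Xr \<Omega> r. \<Sum>y\<in>Xr \<Omega> r. column_kernel \<Omega> s x y * f y * column_sign s a b x)
        = (\<Sum>y\<in>Xr \<Omega> r. f y * (\<Sum>x\<in>Xr \<Omega> r. column_kernel \<Omega> s y x * column_sign s a b x))"
        unfolding sum_distrib_left
        by (subst sum.swap, intro sum.cong refl, subst column_kernel_commute) (simp add: mult_ac)
      also have "\<dots> = (\<Sum>y\<in>Xr \<Omega> r. f y * (?k * column_sign s a b y))"
        by (intro sum.cong refl arg_cong2[where f = "(*)"] sum_column_kernel_column_sign[OF fin col _ r(1)])
           (simp add: Xr_def)
      also have "inverse ?k * \<dots> = (\<Sum>y\<in>Xr \<Omega> r. f y * column_sign s a b y)"
        using kernel_scale_neq_0[OF r] by (simp add: sum_distrib_left mult_ac)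
      finally show "polytab \<Omega> r s a b \<in> {h. (\<Sum>x\<in>Pow \<Omega>. v x * cnj (h x)) = 0}"
        by (simp add: sum_Pow_polytab[OF fin] v_def left_diff_distrib sum_subtractf)
    qed
    moreover have "v \<in> L2X \<Omega>" using f by (auto simp: L2X_def v_def u_def Xr_def)
    ultimately show ?thesis by (auto simp: orth_compl_def)
  qed
  moreover have "f = (\<lambda>x. u x + v x)" by (simp add: v_def)
  ultimately show ?thesis by (rule that)
qed

section \<open>Uniqueness of the normalised operator\<close>

lemma exists_Xr_card_Diff:
  assumes fin: "finite \<Omega>" and "r1 \<le> card \<Omega>" "k \<le> r2" "r2 - k \<le> r1" "k \<le> card \<Omega> - r1"
  obtains x y where "x \<in> Xr \<Omega> r2" "y \<in> Xr \<Omega> r1" "card (x - y) = k"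
proof -
  obtain y where y: "y \<subseteq> \<Omega>" "card y = r1" using assms(2) by (metis obtain_subset_with_card_n)
  have fy: "finite y" using y fin finite_subset by blast
  obtain u where u: "u \<subseteq> y" "card u = r2 - k" using assms(4) y by (metis obtain_subset_with_card_n)
  have "card (\<Omega> - y) = card \<Omega> - r1" using y fy by (simp add: card_Diff_subset)
  then obtain w where w: "w \<subseteq> \<Omega> - y" "card w = k" using assms(5) by (metis obtain_subset_with_card_n)
  have "card (u \<union> w) = card u + card w"
    using u w fy fin by (intro card_Un_disjoint) (auto intro: finite_subset)
  then have "u \<union> w \<in> Xr \<Omega> r2" using u w y assms(3) by (auto simp: Xr_def)
  moreover have "u \<union> w - y = w" using u w by auto
  ultimately show ?thesis using y w by (intro that[of "u \<union> w" y]) (auto simp: Xr_def)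
qed

text \<open>Point masses read off the kernel, so \<open>q\<close> vanishes at every occurring value
  of \<open>card (x - y)\<close>. With truncated subtraction \<open>r2 - r1\<close> is the least
  one, and the bounds on \<open>s\<close> give \<open>s + 1\<close> consecutive values from
  there.\<close>

lemma kernel_op_eq_0_imp_poly_eq_0:
  assumes fin: "finite \<Omega>" and r: "s \<le> r1" "r1 + s \<le> card \<Omega>" "s \<le> r2" "r2 + s \<le> card \<Omega>"
    and deg: "degree q \<le> s" and 0: "\<And>f. f \<in> L2X \<Omega> \<Longrightarrow> kernel_op \<Omega> r1 r2 q f = (\<lambda>_. 0)"
  shows "q = 0"
proof (rule poly_eqI_degree[where A = "(\<lambda>j. of_nat (r2 - r1 + j)) ` {..s}"])
  have "inj_on (\<lambda>j. of_nat (r2 - r1 + j) :: complex) {..s}"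
    by (rule inj_onI) (simp only: of_nat_eq_iff add_left_cancel)
  then have "card ((\<lambda>j. of_nat (r2 - r1 + j) :: complex) ` {..s}) = Suc s"
    by (simp only: card_image card_atMost)
  then show "degree q < card ((\<lambda>j. of_nat (r2 - r1 + j) :: complex) ` {..s})"
    "degree 0 < card ((\<lambda>j. of_nat (r2 - r1 + j) :: complex) ` {..s})"
    using deg by simp_all
  fix t :: complex assume "t \<in> (\<lambda>j. of_nat (r2 - r1 + j)) ` {..s}"
  then obtain j where j: "j \<le> s" "t = of_nat (r2 - r1 + j)" by blast
  have "r1 \<le> card \<Omega>" "r2 - r1 + j \<le> r2" "r2 - (r2 - r1 + j) \<le> r1" "r2 - r1 + j \<le> card \<Omega> - r1"
    using r j(1) by linarith+
  then obtain x y where xy: "x \<in> Xr \<Omega> r2" "y \<in> Xr \<Omega> r1" "card (x - y) = r2 - r1 + j"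
    by (rule exists_Xr_card_Diff[OF fin])
  let ?f = "\<lambda>z. if z = y then 1 else 0 :: complex"
  have "?f \<in> L2X \<Omega>" using xy(2) by (auto simp: L2X_def Xr_def)
  then have "kernel_op \<Omega> r1 r2 q ?f x = 0" using 0 by simp
  moreover have "kernel_op \<Omega> r1 r2 q ?f x = poly q (of_nat (card (x - y)))"
    using xy fin by (simp add: kernel_op_def finite_Xr if_distrib sum.delta cong: if_cong)
  ultimately show "poly q t = poly 0 t" using xy(3) j(2) by simp
qed

text \<open>By equivariance \<open>L\<close> maps a polytabloid to \<open>c\<close> times its
  counterpart at level \<open>r2\<close>; the model operator does so with \<open>d\<close>, which is
  nonzero. The cross-multiplied combination \<open>q\<close> induces zero on the constituent and on
  its orthogonal complement, hence \<open>q = 0\<close>. Evaluation at 0 gives \<open>c = d\<close>,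
  so \<open>c\<close> need not be known to be nonzero beforehand.\<close>

lemma is_Lambda_unique:
  assumes fin: "finite \<Omega>" and r: "s \<le> r1" "r1 + s \<le> card \<Omega>" "s \<le> r2" "r2 + s \<le> card \<Omega>"
    and L: "is_Lambda \<Omega> s r1 r2 L"
  shows "L = kernel_op \<Omega> r1 r2 (Lambda_poly (card \<Omega>) s r1 r2)"
proof -
  let ?p = "Lambda_poly (card \<Omega>) s r1 r2"
  note V = L2Xrs_eq_polytab_space[OF fin r(1,2)]
  obtain p where p: "degree p = s" "poly p 0 = 1" "L = kernel_op \<Omega> r1 r2 p"
    using L by (auto simp: is_Lambda_def)
  define d where "d = inverse (2 ^ s * of_nat (ffact r2 s * ffact (card \<Omega> - r1) s)) * kernel_scale (card \<Omega>) s r1"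
  have d: "d \<noteq> 0" using r kernel_scale_neq_0[OF r(1,2)] by (simp add: d_def ffact_eq_0_iff)
  have dp: "kernel_op \<Omega> r1 r2 ?p (polytab \<Omega> r1 s a b) = (\<lambda>x. d * polytab \<Omega> r2 s a b x)"
    if "columns \<Omega> s a b" for a b
    using kernel_op_Lambda_poly_polytab[OF fin that r(1)] by (simp add: d_def)
  have s2: "2 * s \<le> card \<Omega>" using r by simp
  obtain a b where col: "columns \<Omega> s a b" by (rule exists_columns[OF fin s2])
  have "\<exists>c. L (polytab \<Omega> r1 s a b) = (\<lambda>x. c * polytab \<Omega> r2 s a b x)"
  proof (rule equivariant_eq_scaled_polytab[OF fin col])
    show "L (polytab \<Omega> r1 s a b) \<in> L2Xr \<Omega> r2" by (simp add: p(3) L2Xr_def kernel_op_def)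
    fix i assume i: "i < s"
    have "(\<lambda>x. - polytab \<Omega> r1 s a b x) = (\<lambda>x. - 1 * polytab \<Omega> r1 s a b x)" by simp
    then show "act (transpose (a i) (b i)) (L (polytab \<Omega> r1 s a b)) = (\<lambda>x. - L (polytab \<Omega> r1 s a b) x)"
      by (simp only: p(3) kernel_op_act[OF transpose_permutes[OF col i], symmetric]
          act_transpose_polytab[OF col i] kernel_op_linear(3)) simp
  next
    fix g assume g: "g permutes \<Omega>" "\<And>i. i < s \<Longrightarrow> g (a i) = a i \<and> g (b i) = b i"
    have "polytab \<Omega> r1 s (g \<circ> a) (g \<circ> b) = polytab \<Omega> r1 s a b"
      using g(2) by (intro polytab_cong) auto
    then show "act g (L (polytab \<Omega> r1 s a b)) = L (polytab \<Omega> r1 s a b)"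
      by (simp add: p(3) kernel_op_act[OF g(1), symmetric] act_polytab[OF g(1)])
  qed
  then obtain c where c: "L (polytab \<Omega> r1 s a b) = (\<lambda>x. c * polytab \<Omega> r2 s a b x)" by blast
  define q where "q = smult d p - smult c ?p"
  have q: "kernel_op \<Omega> r1 r2 q f = (\<lambda>x. d * L f x - c * kernel_op \<Omega> r1 r2 ?p f x)" for f
    unfolding q_def kernel_op_smult_diff p(3) ..
  have qV: "kernel_op \<Omega> r1 r2 q f = (\<lambda>_. 0)" if "f \<in> polytab_space \<Omega> r1 s" for f
  proof -
    let ?W = "{f. kernel_op \<Omega> r1 r2 q f = (\<lambda>_. 0)}"
    have "act g (\<lambda>_. 0) = (\<lambda>_. 0)" for g :: "'a \<Rightarrow> 'a" by (simp add: act_def)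
    then have "G_subspace \<Omega> ?W"
      by (auto simp: G_subspace_def csubspace_def G_invariant_def kernel_op_linear kernel_op_act)
    moreover have "polytab \<Omega> r1 s a b \<in> ?W"
      by (simp add: q c dp[OF col])
    ultimately have "polytab_space \<Omega> r1 s \<subseteq> ?W"
      by (rule polytab_space_subset_G_subspace[OF fin col])
    then show ?thesis using that by blast
  qed
  have "q = 0"
  proof (rule kernel_op_eq_0_imp_poly_eq_0[OF fin r])
    show "degree q \<le> s"
      unfolding q_def using p(1) degree_Lambda_poly[OF r(1-3)]
      by (intro degree_diff_le order.trans[OF degree_smult_le]) auto
    fix f assume "f \<in> L2X \<Omega>"
    then obtain u v where u: "u \<in> polytab_space \<Omega> r1 s" and v: "v \<in> orth_compl \<Omega> (polytab_space \<Omega> r1 s)"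
      and f: "f = (\<lambda>x. u x + v x)" by (rule L2X_decompose[OF fin r(1,2)])
    have "L v = (\<lambda>_. 0)" "kernel_op \<Omega> r1 r2 ?p v = (\<lambda>_. 0)"
      using v L is_Lambda_Lambda_poly[OF fin r] unfolding is_Lambda_def V by blast+
    then have "kernel_op \<Omega> r1 r2 q v = (\<lambda>_. 0)" by (simp add: q)
    then show "kernel_op \<Omega> r1 r2 q f = (\<lambda>_. 0)" by (simp add: f kernel_op_linear qV[OF u])
  qed
  then have eq: "smult d p = smult c ?p" by (simp add: q_def)
  then have "poly (smult d p) 0 = poly (smult c ?p) 0" by simp
  then have "d = c" using p(2) poly_Lambda_poly_0[OF r(2,3)] by simp
  then have "smult d p = smult d ?p" using eq by simp
  then have "smult (inverse d) (smult d p) = smult (inverse d) (smult d ?p)" by simp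
  then have "p = ?p" using d by simp
  then show ?thesis using p(3) by simp
qed

lemma Lambda_eq_kernel_op:
  assumes "finite \<Omega>" "s \<le> r1" "r1 + s \<le> card \<Omega>" "s \<le> r2" "r2 + s \<le> card \<Omega>"
  shows "Lambda \<Omega> s r1 r2 = kernel_op \<Omega> r1 r2 (Lambda_poly (card \<Omega>) s r1 r2)"
  unfolding Lambda_def using is_Lambda_Lambda_poly[OF assms] is_Lambda_unique[OF assms]
  by (rule the_equality)

text \<open>The hook length form of the dimension of the constituent, cleared of its
  denominator.\<close>

lemma ichoose_diff:
  assumes "2 * s \<le> n"
  shows "of_nat (n - s + 1) * (of_int (ichoose n (int s) - ichoose n (int s - 1)) :: complex)
    = of_nat (n - 2 * s + 1) * of_nat (n choose s)"
proof (cases s)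
  case 0
  then show ?thesis by (simp add: ichoose_def)
next
  case (Suc t)
  have "Suc t * (n choose Suc t) = (n - t) * (n choose t)"
    by (simp only: binomial_absorption binomial_absorb_comp)
  then have "of_nat (Suc t * (n choose Suc t)) = (of_nat ((n - t) * (n choose t)) :: complex)" by simp
  moreover have "ichoose n (int s) = int (n choose Suc t)" "ichoose n (int s - 1) = int (n choose t)"
    by (simp_all add: ichoose_def Suc nat_add_distrib)
  moreover have "n - s + 1 = n - t" using Suc assms by simp
  ultimately show ?thesis using assms Suc
    by (simp add: of_nat_diff algebra_simps)
qed

text \<open>The left side is the scalar by which \<open>Lambda \<Omega> s r r\<close> acts on its
  constituent.\<close>

lemma kernel_scale_ratio:
  assumes r: "s \<le> r" "r + s \<le> n"
  shows "kernel_scale n s r / (2 ^ s * of_nat (ffact r s * ffact (n - r) s))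
    = of_int (ichoose n (int r)) / of_int (ichoose n (int s) - ichoose n (int s - 1))"
proof -
  \<comment> \<open>In terms of \<open>u\<close>, \<open>v\<close> and \<open>s\<close> every
    argument is a sum, so truncated subtraction disappears and both sides become quotients of
    factorials.\<close>
  define u where "u = r - s"
  define v where "v = n - r - s"
  define m where "m = u + v"
  define X :: complex where "X = of_int (ichoose n (int s) - ichoose n (int s - 1))"
  have n: "n = m + 2 * s" and r': "r = u + s" "n - r = v + s" and sub: "n - 2 * s = m" "r - s = u" "n - s = m + s"
    using r by (auto simp: u_def v_def m_def)
  have 1: "of_nat (m choose u) = (fact m / (fact u * fact v) :: complex)"
    by (simp add: binomial_fact m_def)
  have 2: "of_nat ((m + s + 1) choose s) = (of_nat (m + s + 1) * fact (m + s) / (fact s * (of_nat (m + 1) * fact m)) :: complex)"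
    by (subst binomial_fact) (simp_all add: algebra_simps)
  have 3: "of_nat (n choose s) = (fact n / (fact s * fact (m + s)) :: complex)"
    by (subst binomial_fact) (simp_all add: sub(3) n add.commute)
  have 4: "of_nat (n choose r) = (fact n / (fact (u + s) * fact (v + s)) :: complex)"
    using r by (subst binomial_fact) (simp_all add: r' flip: r'(2))
  have ff: "of_nat (ffact (k + s) s) = (fact (k + s) / fact k :: complex)" for k
  proof -
    have "of_nat (ffact (k + s) s * fact k) = (of_nat (fact (k + s)) :: complex)"
      using ffact_fact[of s "k + s"] by simp
    then show ?thesis by (simp add: field_simps)
  qed
  have "of_nat (m + s + 1) * X = of_nat (m + 1) * of_nat (n choose s)"
    using ichoose_diff[of s n] r by (simp only: X_def sub)
  then have X: "X = of_nat (m + 1) * fact n / (fact s * fact (m + s) * of_nat (m + s + 1))"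
    unfolding 3 by (simp add: field_simps del: of_nat_add of_nat_Suc)
  have nz: "(of_nat (m + 1) :: complex) \<noteq> 0" "(of_nat (m + s + 1) :: complex) \<noteq> 0"
    unfolding of_nat_eq_0_iff by simp_all
  have ff_r: "of_nat (ffact r s) = (fact (u + s) / fact u :: complex)"
    "of_nat (ffact (n - r) s) = (fact (v + s) / fact v :: complex)"
    by (simp_all only: r'(2) ff) (simp only: r'(1) ff)
  have scale: "kernel_scale n s r = fact m / (fact u * fact v) * (2 ^ s * fact s ^ 2 *
      (of_nat (m + s + 1) * fact (m + s) / (fact s * (of_nat (m + 1) * fact m))))"
    by (simp only: kernel_scale_def sub 1 2)
  have "kernel_scale n s r / (2 ^ s * of_nat (ffact r s * ffact (n - r) s)) = of_nat (n choose r) / X"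
    unfolding scale 4 X of_nat_mult ff_r
    using nz by (simp add: field_simps power2_eq_square del: of_nat_add of_nat_Suc)
  then show ?thesis by (simp add: X_def ichoose_def)
qed

theorem theorem2:
  fixes \<Omega> :: "'a set" and n r1 r2 r3 s :: nat
  assumes "finite \<Omega>" and "card \<Omega> = n" and "n \<ge> 1"
    and "r1 \<le> n" and "r2 \<le> n" and "r3 \<le> n"
    and "s \<le> min r1 (min (n - r1) (min r2 (min (n - r2) (min r3 (n - r3)))))"
  shows "Lambda \<Omega> s r2 r3 \<circ> Lambda \<Omega> s r1 r2 =
    (\<lambda>\<psi> x. (of_int (ichoose n (int r2)) / of_int (ichoose n (int s) - ichoose n (int s - 1)))
             * Lambda \<Omega> s r1 r3 \<psi> x)"
proof (intro ext)
  fix f :: "'a set \<Rightarrow> complex" and x :: "'a set"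
  have fin: "finite \<Omega>" by fact
  have r: "s \<le> r1" "r1 + s \<le> card \<Omega>" "s \<le> r2" "r2 + s \<le> card \<Omega>" "s \<le> r3" "r3 + s \<le> card \<Omega>"
    using assms by auto
  note L = Lambda_eq_kernel_op[OF fin r(1-4)] Lambda_eq_kernel_op[OF fin r(3-6)]
    Lambda_eq_kernel_op[OF fin r(1,2,5,6)]
  define \<mu> where "\<mu> = (\<lambda>r r'. 2 ^ s * of_nat (ffact r' s * ffact (n - r) s) :: complex)"
  have \<mu>0: "\<mu> r r' \<noteq> 0" if "r + s \<le> n" "s \<le> r'" for r r'
    using that by (simp add: \<mu>_def ffact_eq_0_iff)
  have K: "kernel_op \<Omega> r r' (Lambda_poly n s r r') h y
      = inverse (\<mu> r r') * (\<Sum>z\<in>Xr \<Omega> r. column_kernel \<Omega> s y z * h z)" if "y \<in> Xr \<Omega> r'" for r r' h y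
    using kernel_op_Lambda_poly[OF fin that, of r s h] assms(2) by (simp add: \<mu>_def)
  show "(Lambda \<Omega> s r2 r3 \<circ> Lambda \<Omega> s r1 r2) f x
    = of_int (ichoose n (int r2)) / of_int (ichoose n (int s) - ichoose n (int s - 1)) * Lambda \<Omega> s r1 r3 f x"
  proof (cases "x \<in> Xr \<Omega> r3")
    case True
    then have x: "x \<subseteq> \<Omega>" by (simp add: Xr_def)
    have "(Lambda \<Omega> s r2 r3 \<circ> Lambda \<Omega> s r1 r2) f x
      = inverse (\<mu> r2 r3) * (\<Sum>y\<in>Xr \<Omega> r2. column_kernel \<Omega> s x y *
          (inverse (\<mu> r1 r2) * (\<Sum>z\<in>Xr \<Omega> r1. column_kernel \<Omega> s y z * f z)))"
      unfolding L o_def \<open>card \<Omega> = n\<close> K[OF True]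
      by (intro arg_cong2[where f = "(*)"] sum.cong refl) (simp add: K)
    also have "\<dots> = inverse (\<mu> r2 r3) * inverse (\<mu> r1 r2)
        * (\<Sum>y\<in>Xr \<Omega> r2. \<Sum>z\<in>Xr \<Omega> r1. column_kernel \<Omega> s x y * column_kernel \<Omega> s y z * f z)"
      by (simp add: sum_distrib_left mult_ac)
    also have "(\<Sum>y\<in>Xr \<Omega> r2. \<Sum>z\<in>Xr \<Omega> r1. column_kernel \<Omega> s x y * column_kernel \<Omega> s y z * f z)
        = (\<Sum>z\<in>Xr \<Omega> r1. (\<Sum>y\<in>Xr \<Omega> r2. column_kernel \<Omega> s x y * column_kernel \<Omega> s y z) * f z)"
      unfolding sum_distrib_right by (rule sum.swap)
    also have "\<dots> = kernel_scale n s r2 * (\<Sum>z\<in>Xr \<Omega> r1. column_kernel \<Omega> s x z * f z)"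
      using assms(2) by (simp add: column_kernel_compose[OF fin x r(3)] sum_distrib_left mult.assoc)
    also have "(\<Sum>z\<in>Xr \<Omega> r1. column_kernel \<Omega> s x z * f z) = \<mu> r1 r3 * Lambda \<Omega> s r1 r3 f x"
      unfolding L(3) \<open>card \<Omega> = n\<close> K[OF True] using \<mu>0[of r1 r3] r assms(2) by simp
    also have "inverse (\<mu> r2 r3) * inverse (\<mu> r1 r2) * (kernel_scale n s r2 * (\<mu> r1 r3 * Lambda \<Omega> s r1 r3 f x))
      = kernel_scale n s r2 / (2 ^ s * of_nat (ffact r2 s * ffact (n - r2) s)) * Lambda \<Omega> s r1 r3 f x"
    proof -
      \<comment> \<open>\<open>\<mu> r r'\<close> is a factor in \<open>r\<close> times a factor in
        \<open>r'\<close>, so the two factors belonging to \<open>r2\<close> can be split off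
        together.\<close>
      have "\<mu> r2 r3 * \<mu> r1 r2 = \<mu> r1 r3 * (2 ^ s * of_nat (ffact r2 s * ffact (n - r2) s))"
        by (simp add: \<mu>_def mult_ac)
      moreover have "\<mu> r2 r3 \<noteq> 0" "\<mu> r1 r2 \<noteq> 0" "\<mu> r1 r3 \<noteq> 0"
        "(2 ^ s * of_nat (ffact r2 s * ffact (n - r2) s) :: complex) \<noteq> 0"
        using \<mu>0 r assms(2) by (auto simp: ffact_eq_0_iff)
      ultimately show ?thesis by (simp add: field_simps)
    qed
    also have "kernel_scale n s r2 / (2 ^ s * of_nat (ffact r2 s * ffact (n - r2) s))
      = of_int (ichoose n (int r2)) / of_int (ichoose n (int s) - ichoose n (int s - 1))"
      using r(3,4) assms(2) by (intro kernel_scale_ratio) auto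
    finally show ?thesis .
  qed (simp add: L kernel_op_def)
qed

end
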